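(* Let $G$ be a non-cyclic finite group of order $n$. Then the following statements hold. (1) If $G$ is of even order, then $\frac{\psi(G)}{\psi(C_n)}\leq \frac{7}{11}$, and equality holds if and only if $n=4k$ with $(k,2)=1$ and $G\cong C_2\times C_2\times C_k$. (2) If $G$ is of odd order, then $\frac{\psi(G)}{\psi(C_n)}\leq \frac{25}{61}$, and equality holds if and only if $n=9k$ with $(k,6)=1$ and $G\cong C_3\times C_3\times C_k$.
   Context: For a finite group $G$, $\psi(G)=\sum_{x\in G}o(x)$, where $o(x)$ is the order of $x$. $C_t$ denotes the cyclic group of order $t$. $(a,b)$ denotes the greatest common divisor of integers $a,b$. *)

theory Defs
  imports Complex_Main "HOL-Algebra.Algebra"
begin

definition psi :: "('a, 'b) monoid_scheme \<Rightarrow> nat"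
  where "psi G = (\<Sum>x\<in>carrier G. group.ord G x)"

text \<open>The cyclic group of order \<open>t\<close>, for \<open>t \<ge> 1\<close>; for \<open>t = 0\<close> this is the infinite cyclic group.\<close>

abbreviation cyc :: "nat \<Rightarrow> int monoid"
  where "cyc t \<equiv> integer_mod_group t"

end

theory Submission
  imports Defs "HOL-Number_Theory.Residues"
begin

text \<open>Write \<open>q = 2\<close> or \<open>q = 3\<close> according to the parity of \<open>n\<close>, so that the asserted constant is
  \<open>\<psi>(C\<^sub>q \<times> C\<^sub>q) / \<psi>(C\<^bsub>q\<^sup>2\<^esub>)\<close>, and let \<open>p\<close> be the largest prime divisor of \<open>n\<close>. Telescoping the
  product formula gives \<open>\<psi>(C\<^sub>n) \<ge> q n\<^sup>2 / (p + 1)\<close>, so if the ratio is not below the constant then some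
  cyclic subgroup \<open>H\<close> has a small index \<open>k\<close>: either \<open>k < p\<close>, or \<open>k = p \<le> 3\<close>.

  If \<open>k < p\<close>, then \<open>H\<close> contains a Sylow \<open>p\<close>-subgroup \<open>P\<close> of \<open>G\<close>, which acts trivially on the fewer than \<open>p\<close>
  cosets other than \<open>H\<close>, so \<open>P\<close> is a normal cyclic subgroup. Summing the orders over the cosets of \<open>P\<close>
  gives \<open>\<psi>(G) \<le> \<psi>(P) \<psi>(G/P)\<close>, with equality only for central \<open>P\<close>. When \<open>G/P\<close> is not cyclic this is
  an induction step; when \<open>G/P\<close> is cyclic, \<open>P\<close> is not central and the coset sums are known exactly,
  giving a strict inequality.

  In the remaining cases \<open>n\<close> is a power of \<open>q\<close>, or \<open>n\<close> is even, \<open>p = 3\<close> and \<open>k = 3\<close>. There it suffices to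
  bound the orders outside \<open>H\<close> by \<open>n/k\<close>, and equality forces \<open>n = q\<^sup>2\<close>.\<close>

hide_const (open) Divisibility.prime

section \<open>Element orders in cyclic groups\<close>

text \<open>The residue \<open>i\<close> has order \<open>n div gcd n i\<close> in Z/n, so for
  \<open>n > 0\<close> this is psi(C_n) (see \<open>psi_cyc\<close>), as a purely arithmetic
  sum.\<close>

definition cyc_psi :: "nat \<Rightarrow> nat"
  where "cyc_psi n = (\<Sum>i<n. n div gcd n i)"

lemma cyc_psi_1 [simp]: "cyc_psi (Suc 0) = 1"
  by (simp add: cyc_psi_def)

lemma gcd_mult_coprime_left:
  fixes m n x :: nat
  assumes "coprime m n"
  shows "gcd (m * n) x = gcd m x * gcd n x"
proof (rule dvd_antisym)
  have "coprime (gcd m x) (gcd n x)"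
    using assms by (meson coprime_divisors gcd_dvd1)
  then show "gcd m x * gcd n x dvd gcd (m * n) x"
    by (simp add: divides_mult mult_dvd_mono)
  have "gcd (m * n) x = gcd (gcd (m * n) (m * x)) x"
    by (metis dvd_triv_right gcd.assoc gcd_nat.absorb2)
  also have "\<dots> = gcd (m * gcd n x) x" by (simp add: gcd_mult_distrib_nat)
  also have "\<dots> dvd gcd m x * gcd n x"
  proof -
    have "gcd (m * gcd n x) x dvd gcd (m * gcd n x) (x * gcd n x)"
      by (simp add: dvd_mult2)
    then show ?thesis by (metis gcd_mult_distrib_nat mult.commute)
  qed
  finally show "gcd (m * n) x dvd gcd m x * gcd n x" .
qed

text \<open>Chinese remaindering: the residues of \<open>x\<close> modulo \<open>m\<close> and
  \<open>n\<close> run through all pairs exactly once, and \<open>gcd (m * n) x\<close> factors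
  accordingly.\<close>

lemma cyc_psi_mult_coprime:
  assumes "coprime m n"
  shows "cyc_psi (m * n) = cyc_psi m * cyc_psi n"
proof (cases "m = 0 \<or> n = 0")
  case True
  then show ?thesis by (auto simp: cyc_psi_def)
next
  case False
  then have pos: "m > 0" "n > 0" by auto
  have inj: "inj_on (\<lambda>x. (x mod m, x mod n)) {..<m * n}"
  proof (rule inj_onI)
    fix x y assume xy: "x \<in> {..<m * n}" "y \<in> {..<m * n}" "(x mod m, x mod n) = (y mod m, y mod n)"
    then have "[x = y] (mod m * n)"
      using assms by (intro coprime_cong_mult_nat) (auto simp: cong_def)
    with xy show "x = y" by (auto simp: cong_def)
  qed
  have "(\<lambda>x. (x mod m, x mod n)) ` {..<m * n} = {..<m} \<times> {..<n}"
    by (rule card_subset_eq) (use pos in \<open>auto simp: card_image[OF inj] card_cartesian_product\<close>)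
  with inj have bij: "bij_betw (\<lambda>x. (x mod m, x mod n)) {..<m * n} ({..<m} \<times> {..<n})"
    by (auto simp: bij_betw_def)
  have "cyc_psi m * cyc_psi n = (\<Sum>(i,j)\<in>{..<m} \<times> {..<n}. (m div gcd m i) * (n div gcd n j))"
    by (simp add: cyc_psi_def sum_product sum.cartesian_product)
  also have "\<dots> = (\<Sum>x<m * n. (m div gcd m (x mod m)) * (n div gcd n (x mod n)))"
    by (subst sum.reindex_bij_betw[OF bij, symmetric]) simp
  also have "\<dots> = (\<Sum>x<m * n. (m * n) div gcd (m * n) x)"
  proof (rule sum.cong)
    fix x
    have "gcd m (x mod m) = gcd m x" "gcd n (x mod n) = gcd n x"
      by (metis gcd_red_nat gcd.commute)+
    moreover have "gcd (m * n) x = gcd m x * gcd n x"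
      using assms by (simp add: gcd_mult_coprime_left)
    ultimately show "m div gcd m (x mod m) * (n div gcd n (x mod n)) = m * n div gcd (m * n) x"
      by (simp add: div_mult_div_if_dvd)
  qed simp
  finally show ?thesis by (simp add: cyc_psi_def)
qed

text \<open>The multiples of \<open>p\<close> in Z/p^(b+1) form a copy of Z/p^b with the same
  orders; every other residue is prime to \<open>p\<close> and has full order.\<close>

lemma cyc_psi_prime_power_Suc:
  assumes "prime p"
  shows "cyc_psi (p ^ Suc b) = cyc_psi (p ^ b) + p ^ Suc b * (p ^ Suc b - p ^ b)"
proof -
  let ?N = "p ^ Suc b" and ?M = "(*) p ` {..<p ^ b}"
  have p0: "p > 0" using assms prime_gt_0_nat by blast
  have sub: "?M \<subseteq> {..<?N}" using p0 by auto
  have cardM: "card ?M = p ^ b" using p0 by (subst card_image) (auto simp: inj_on_def)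
  have "(\<Sum>i\<in>?M. ?N div gcd ?N i) = (\<Sum>j<p ^ b. ?N div gcd ?N (p * j))"
    using p0 by (subst sum.reindex) (auto simp: inj_on_def)
  also have "\<dots> = cyc_psi (p ^ b)"
    unfolding cyc_psi_def using p0 by (intro sum.cong) (auto simp: gcd_mult_distrib_nat[symmetric])
  finally have 1: "(\<Sum>i\<in>?M. ?N div gcd ?N i) = cyc_psi (p ^ b)" .
  have "(\<Sum>i\<in>{..<?N} - ?M. ?N div gcd ?N i) = (\<Sum>i\<in>{..<?N} - ?M. ?N)"
  proof (rule sum.cong)
    fix i assume i: "i \<in> {..<?N} - ?M"
    have "\<not> p dvd i"
    proof
      assume "p dvd i"
      then obtain j where "i = p * j" ..
      with i p0 show False by auto
    qed
    then have "coprime p i" using assms prime_imp_coprime by blast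
    then have "gcd ?N i = 1" by (metis coprime_iff_gcd_eq_1 coprime_power_left_iff)
    then show "?N div gcd ?N i = ?N" by simp
  qed simp
  also have "\<dots> = ?N * (?N - p ^ b)"
    using sub cardM by (simp add: card_Diff_subset)
  finally show ?thesis
    using 1 sum.subset_diff[OF sub, of "\<lambda>i. ?N div gcd ?N i"] by (simp add: cyc_psi_def)
qed

text \<open>The recurrence sums to (p^(2b+1) + 1) / (p + 1); multiplying by \<open>p + 1\<close>
  keeps this closed form in the naturals.\<close>

lemma cyc_psi_prime_power:
  assumes "prime p"
  shows "(p + 1) * cyc_psi (p ^ b) = p * (p ^ b)\<^sup>2 + 1"
proof (induction b)
  case (Suc b)
  have "p \<ge> 1" using assms prime_ge_1_nat by blast
  then obtain r where r: "p = Suc r" by (cases p) auto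
  have "p ^ Suc b - p ^ b = r * p ^ b" by (simp add: r)
  then have "cyc_psi (p ^ Suc b) = cyc_psi (p ^ b) + p ^ Suc b * (r * p ^ b)"
    using cyc_psi_prime_power_Suc[OF assms] by simp
  then have "(p + 1) * cyc_psi (p ^ Suc b) = p * (p ^ b)\<^sup>2 + 1 + (p + 1) * (p ^ Suc b * (r * p ^ b))"
    using Suc.IH by (simp add: add_mult_distrib2)
  also have "\<dots> = p * (p ^ Suc b)\<^sup>2 + 1"
    by (simp add: r algebra_simps power2_eq_square)
  finally show ?case .
qed simp

lemma prime_power_decomp:
  fixes n p :: nat
  assumes "prime p" "n > 0"
  obtains b m where "n = p ^ b * m" "\<not> p dvd m" "coprime (p ^ b) m" "m > 0"
proof -
  from assms obtain m where m: "n = p ^ multiplicity p n * m" "\<not> p dvd m"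
    by (metis multiplicity_decompose' not_prime_unit less_numeral_extra(3))
  moreover have "coprime (p ^ multiplicity p n) m"
    using m(2) assms(1) prime_imp_coprime coprime_power_left_iff by blast
  moreover have "m > 0" using m(2) by (cases m) auto
  ultimately show ?thesis using that by blast
qed

text \<open>A prime r dividing \<open>n\<close> contributes to psi(C_n) / n^2 a factor above r / (r
  + 1). Including this factor for every integer r from \<open>q\<close> to \<open>s - 1\<close> only
  lowers the bound, and the product telescopes to q / s. The induction on \<open>s\<close> takes one
  such r at a time.\<close>

lemma cyc_psi_lower_bound:
  assumes "n > 0" "q > 0" "\<And>r. prime r \<Longrightarrow> r dvd n \<Longrightarrow> q \<le> r \<and> r < s" "q \<le> s"
  shows "q * n\<^sup>2 \<le> s * cyc_psi n"
  using assms(4,1,3)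
proof (induction s arbitrary: n rule: dec_induct)
  case base
  have "n = 1"
    using base.prems by (meson leD prime_factor_nat)
  then show ?case by simp
next
  case (step s)
  show ?case
  proof (cases "prime s")
    case False
    have "q * n\<^sup>2 \<le> s * cyc_psi n"
      by (rule step.IH) (use step.prems False in \<open>auto simp: less_Suc_eq\<close>)
    then show ?thesis by simp
  next
    case True
    obtain b m where m: "n = s ^ b * m" "\<not> s dvd m" "coprime (s ^ b) m" "m > 0"
      using prime_power_decomp True step.prems by blast
    have "q * m\<^sup>2 \<le> s * cyc_psi m"
    proof (rule step.IH)
      fix r assume r: "prime r" "r dvd m"
      then have "r \<noteq> s" using m by auto
      with step.prems(2)[of r] r m(1) show "q \<le> r \<and> r < s" by fastforce
    qed (use m in auto)
    then have "(s ^ b)\<^sup>2 * (q * m\<^sup>2) \<le> (s ^ b)\<^sup>2 * (s * cyc_psi m)" by (rule mult_left_mono) simp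
    also have "\<dots> \<le> (s * (s ^ b)\<^sup>2 + 1) * cyc_psi m" by (simp add: algebra_simps)
    also have "\<dots> = Suc s * cyc_psi n"
      unfolding cyc_psi_prime_power[OF True, symmetric] m(1) cyc_psi_mult_coprime[OF m(3)] by (simp add: algebra_simps)
    finally show ?thesis by (simp add: m(1) power_mult_distrib mult_ac)
  qed
qed

text \<open>By multiplicativity only the \<open>l\<close>-part of \<open>n\<close> matters. The
  quotient of consecutive values at powers of \<open>l\<close> is smallest at the first step, where
  it is psi(C_l) = l (l - 1) + 1.\<close>

lemma cyc_psi_div_prime:
  assumes "prime l" "l dvd n" "n > 0"
  shows "(l * (l - 1) + 1) * cyc_psi (n div l) \<le> cyc_psi n"
proof -
  obtain r where r: "l = Suc r" using assms(1) by (cases l) auto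
  obtain b m where m: "n = l ^ b * m" "\<not> l dvd m" "coprime (l ^ b) m" "m > 0"
    using prime_power_decomp assms by blast
  with assms obtain e where e: "b = Suc e" by (cases b) auto
  have cop: "coprime (l ^ e) m" using m(3) e by simp
  have "n = l * (l ^ e * m)" using m(1) e by simp
  then have "n div l = l ^ e * m" using r by (metis nonzero_mult_div_cancel_left nat.distinct(1))
  then have 1: "cyc_psi (n div l) = cyc_psi (l ^ e) * cyc_psi m"
    using cyc_psi_mult_coprime[OF cop] by simp
  have 2: "cyc_psi n = cyc_psi (l ^ b) * cyc_psi m"
    using cyc_psi_mult_coprime[OF m(3)] m(1) by simp
  have le: "1 \<le> (l ^ e)\<^sup>2" using r by simp
  have "(l + 1) * ((l * (l - 1) + 1) * cyc_psi (l ^ e)) = (l * r + 1) * (l * (l ^ e)\<^sup>2 + 1)"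
    using cyc_psi_prime_power[OF assms(1), of e] r
    by (metis diff_Suc_1 mult.left_commute)
  also have "\<dots> = l * r * l * (l ^ e)\<^sup>2 + l * r + l * (l ^ e)\<^sup>2 + 1"
    by (simp add: algebra_simps)
  also have "\<dots> \<le> l * r * l * (l ^ e)\<^sup>2 + l * r * (l ^ e)\<^sup>2 + l * (l ^ e)\<^sup>2 + 1"
    using le by (simp add: r)
  also have "\<dots> = l * (l ^ b)\<^sup>2 + 1"
    by (simp add: e r power_mult_distrib power2_eq_square algebra_simps)
  also have "\<dots> = (l + 1) * cyc_psi (l ^ b)" using cyc_psi_prime_power[OF assms(1)] by simp
  finally have "(l * (l - 1) + 1) * cyc_psi (l ^ e) \<le> cyc_psi (l ^ b)"
    by (metis add_gr_0 mult_le_cancel1 zero_less_one)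
  then have "(l * (l - 1) + 1) * cyc_psi (l ^ e) * cyc_psi m \<le> cyc_psi (l ^ b) * cyc_psi m"
    by (rule mult_right_mono) simp
  then show ?thesis by (simp only: 1 2 mult.assoc)
qed

text \<open>For a cyclic group P of order p^b, the ratio |P| / psi(P) is largest at
  \<open>b = 1\<close>. It measures how much a coset of P loses when it does not centralize
  P.\<close>

lemma prime_power_le_cyc_psi:
  assumes "prime p" "b > 0"
  shows "(p * (p - 1) + 1) * p ^ b \<le> p * cyc_psi (p ^ b)"
proof -
  obtain r where r: "p = Suc r" using assms(1) by (cases p) auto
  obtain e where e: "b = Suc e" using assms(2) by (cases b) auto
  \<comment> \<open>As p <= p^b, substituting \<open>p + d\<close> leaves polynomials in
    \<open>r\<close> and \<open>d\<close> that can be compared term by term.\<close>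
  obtain d where d: "p ^ b = p + d"
    using r e by (metis le_add1 le_iff_add mult.commute mult_le_mono1 mult_1 one_le_power plus_1_eq_Suc power_Suc)
  have "(p + 1) * ((p * (p - 1) + 1) * p ^ b) \<le> p * (p * (p ^ b)\<^sup>2 + 1)"
    unfolding d by (simp add: r power2_eq_square algebra_simps)
  also have "\<dots> = (p + 1) * (p * cyc_psi (p ^ b))"
    unfolding cyc_psi_prime_power[OF assms(1), symmetric] by (simp only: mult_ac)
  finally show ?thesis by (metis add_gr_0 mult_le_cancel1 zero_less_one)
qed

text \<open>In each pair of residues 2j, 2j + 1 the first has order at most n / 2 and the second at
  most \<open>n\<close>.\<close>

lemma cyc_psi_le_even:
  assumes "even n"
  shows "4 * cyc_psi n \<le> 3 * n\<^sup>2"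
proof -
  obtain t where t: "n = 2 * t" using assms by auto
  have "cyc_psi n = (\<Sum>i<t * 2. n div gcd n i)" by (simp add: cyc_psi_def t mult.commute)
  also have "\<dots> = (\<Sum>j<t. n div gcd n (2 * j) + n div gcd n (2 * j + 1))"
    unfolding sum.nat_group[symmetric] by (simp add: numeral_2_eq_2 mult.commute)
  also have "\<dots> \<le> (\<Sum>j<t. t + n)"
  proof (intro sum_mono add_mono)
    fix j assume "j \<in> {..<t}"
    then have "t > 0" by auto
    then have "gcd n (2 * j) \<ge> 2" unfolding t by (intro dvd_imp_le) auto
    then have "n div gcd n (2 * j) \<le> n div 2" by (intro div_le_mono2) auto
    then show "n div gcd n (2 * j) \<le> t" by (simp add: t)
  qed simp
  also have "\<dots> = 3 * t\<^sup>2" by (simp add: t power2_eq_square)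
  finally show ?thesis by (simp add: t power_mult_distrib)
qed

section \<open>Powers, cyclic subgroups, conjugation and quotients in a group\<close>

context group
begin

lemma pow_eq_iff_cong:
  assumes "x \<in> carrier G"
  shows "x [^] (i::nat) = x [^] (j::nat) \<longleftrightarrow> [i = j] (mod ord x)"
proof -
  have "x [^] i = x [^] j \<longleftrightarrow> int (ord x) dvd (int j - int i)"
    using int_pow_eq[OF assms, of "int i" "int j"] by (simp add: int_pow_int)
  also have "\<dots> \<longleftrightarrow> [i = j] (mod ord x)"
    by (metis cong_iff_dvd_diff cong_int_iff cong_sym_eq)
  finally show ?thesis .
qed

lemma inj_on_pow_lessThan_ord:
  assumes "x \<in> carrier G"
  shows "inj_on (\<lambda>i::nat. x [^] i) {..<ord x}"
  using assms by (auto simp: inj_on_def pow_eq_iff_cong cong_def)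

lemma generate_eq_pow_image:
  assumes "x \<in> carrier G" "ord x > 0"
  shows "generate G {x} = (\<lambda>i::nat. x [^] i) ` {..<ord x}"
proof -
  have "\<exists>j::nat. j < ord x \<and> x [^] (k::nat) = x [^] j" for k
    using assms by (intro exI[of _ "k mod ord x"]) (auto simp: pow_eq_iff_cong)
  then show ?thesis
    using generate_pow_nat[of x] assms by auto
qed

lemma sum_ord_generate:
  assumes "x \<in> carrier G" "ord x > 0"
  shows "(\<Sum>w\<in>generate G {x}. ord w) = cyc_psi (ord x)"
  unfolding generate_eq_pow_image[OF assms] cyc_psi_def
  using assms by (subst sum.reindex[OF inj_on_pow_lessThan_ord]) (auto intro!: sum.cong simp: ord_pow_gen)

lemma cyclic_group_iff_ord:
  assumes "finite (carrier G)"
  shows "cyclic_group G \<longleftrightarrow> (\<exists>x\<in>carrier G. ord x = order G)"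
proof
  assume "cyclic_group G"
  then show "\<exists>x\<in>carrier G. ord x = order G"
    unfolding cyclic_group_def by (metis cyclic_order_is_ord)
next
  assume "\<exists>x\<in>carrier G. ord x = order G"
  then obtain x where x: "x \<in> carrier G" "ord x = order G" by blast
  have "generate G {x} = carrier G"
    using x assms by (intro card_subset_eq generate_incl) (auto simp: generate_pow_card[symmetric] order_def)
  then have "carrier G = range (\<lambda>n::int. x [^] n)"
    using generate_pow[OF x(1)] by (simp add: full_SetCompr_eq)
  then show "cyclic_group G"
    unfolding cyclic_group using x(1) by blast
qed

lemma conj_nat_pow:
  assumes "g \<in> carrier G" "x \<in> carrier G"
  shows "(g \<otimes> x \<otimes> inv g) [^] (k::nat) = g \<otimes> x [^] k \<otimes> inv g"
proof (induction k)
  case (Suc k)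
  have "inv g \<otimes> (g \<otimes> (x \<otimes> inv g)) = x \<otimes> inv g"
    using assms by (simp add: m_assoc[symmetric])
  with Suc show ?case using assms by (simp add: m_assoc)
qed (use assms in simp)

text \<open>The cosets of \<open>H\<close> other than \<open>H\<close> itself are permuted by \<open>y\<close>; there are fewer than \<open>p\<close>
  of them, so \<open>y\<close> fixes each of them.\<close>

lemma conj_mem_small_index:
  assumes fin: "finite (carrier G)" and H: "subgroup H G" and y: "y \<in> H" "ord y = p ^ b"
    and p: "prime p" and idx: "order G \<le> p * card H" and g: "g \<in> carrier G"
  shows "g \<otimes> y \<otimes> inv g \<in> H"
proof (cases "g \<in> H")
  case True
  then show ?thesis using H y by (simp add: subgroup_def)
next
  case False
  interpret H: subgroup H G by (rule H)
  have yG: "y \<in> carrier G" using y H.subset by blast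
  have cH: "card H > 0" using fin H.subset finite_subset H.one_closed card_gt_0_iff by blast
  have fr: "finite (rcosets H)"
    using fin rcosets_subset_PowG[OF H] by (meson finite_Pow_iff finite_subset)
  have "card (rcosets H) * card H \<le> p * card H" using lagrange[OF H] idx by simp
  then have le: "card (rcosets H) \<le> p" using cH by simp
  \<comment> \<open>None of these cosets is \<open>H\<close>, so for \<open>i < p\<close> they take
    fewer than \<open>p\<close> values and two of them coincide.\<close>
  let ?f = "\<lambda>i::nat. H #> (g \<otimes> y [^] i)"
  have "?f ` {..<p} \<subseteq> rcosets H - {H}"
  proof clarify
    fix i :: nat
    have "y [^] i \<in> H" using y(1) by (induction i) auto
    then have "g = (g \<otimes> y [^] i) \<otimes> inv (y [^] i)" "inv (y [^] i) \<in> H"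
      using g yG by (auto simp: m_assoc)
    then have "g \<otimes> y [^] i \<notin> H" using False H.m_closed by metis
    then have "?f i \<noteq> H" using coset_join1[OF _ _ H] g yG by auto
    then show "?f i \<in> rcosets H - {H}" using g yG H.subset by (simp add: rcosetsI)
  qed
  moreover have "H \<in> rcosets H"
    using rcosetsI[OF H.subset one_closed] H.subset by simp
  ultimately have "card (?f ` {..<p}) \<le> card (rcosets H) - 1"
    using card_mono[of "rcosets H - {H}" "?f ` {..<p}"] fr by (simp add: card_Diff_singleton)
  also have "\<dots> < p" using le prime_gt_0_nat[OF p] by linarith
  finally have "\<not> inj_on ?f {..<p}" by (auto dest: card_image)
  then obtain i j where ij: "i < j" "j < p" "?f i = ?f j"
    unfolding inj_on_def by (metis lessThan_iff linorder_neqE_nat)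
  define d where "d = j - i"
  have "g \<otimes> y [^] j \<in> H #> (g \<otimes> y [^] i)"
    using ij(3) rcos_self[OF _ H, of "g \<otimes> y [^] j"] g yG by simp
  then obtain w where w: "w \<in> H" "g \<otimes> y [^] j = w \<otimes> (g \<otimes> y [^] i)"
    by (auto simp: r_coset_def)
  have wG: "w \<in> carrier G" using w H.subset by blast
  have "y [^] j = y [^] d \<otimes> y [^] i" using ij yG by (simp add: d_def nat_pow_mult)
  with w have "(g \<otimes> y [^] d) \<otimes> y [^] i = (w \<otimes> g) \<otimes> y [^] i"
    using g yG wG by (simp add: m_assoc)
  then have "g \<otimes> y [^] d = w \<otimes> g" using g yG wG by simp
  then have wd: "g \<otimes> y [^] d \<otimes> inv g = w" using g yG wG by (simp add: m_assoc)
  \<comment> \<open>The coincidence puts the conjugate of \<open>y [^] d\<close> into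
    \<open>H\<close>. Since 0 < d < p, \<open>d\<close> is invertible modulo the order of
    \<open>y\<close>; thus \<open>y\<close> is a power of \<open>y [^] d\<close>, and its conjugate
    lies in \<open>H\<close> too.\<close>
  have "coprime d (p ^ b)"
  proof -
    have "\<not> p dvd d" using ij unfolding d_def by (auto dest: dvd_imp_le)
    then show ?thesis using p prime_imp_coprime by (metis coprime_commute coprime_power_right_iff)
  qed
  then obtain u where u: "[d * u = 1] (mod ord y)"
    unfolding y(2) using cong_solve_coprime_nat by fastforce
  have "y [^] (d * u) = y [^] (1::nat)" using u pow_eq_iff_cong[OF yG] by blast
  then have "y = y [^] (d * u)" using yG by simp
  also have "\<dots> = (y [^] d) [^] u" using yG by (simp add: nat_pow_pow)
  finally have "g \<otimes> y \<otimes> inv g = w [^] u"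
    using conj_nat_pow[OF g, of "y [^] d" u] yG wd by simp
  also have "w [^] u \<in> H" using w(1) by (induction u) auto
  finally show ?thesis .
qed

text \<open>A finite cyclic group has only one subgroup of order \<open>N\<close>, and it contains
  every solution of w^N = 1. This uniqueness is what turns information about orders into
  membership.\<close>

lemma generate_mem_of_pow:
  assumes x: "x \<in> carrier G" "ord x > 0" "N dvd ord x" and w: "w \<in> generate G {x}" "w [^] N = \<one>"
  shows "w \<in> generate G {x [^] (ord x div N)}"
proof -
  obtain i :: nat where i: "w = x [^] i" using w generate_eq_pow_image[OF x(1,2)] by auto
  obtain e where e: "ord x = N * e" using x(3) ..
  then have N: "N > 0" "ord x div N = e" using x(2) by auto
  have "ord x dvd i * N" using w(2) i x(1) by (simp add: nat_pow_pow pow_eq_id)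
  then have "e dvd i" using e N by (simp add: mult.commute)
  then obtain t where "i = e * t" ..
  then have "w = (x [^] e) [^] int t" using i x(1) by (simp add: nat_pow_pow int_pow_int)
  then show ?thesis using x(1) N generate_pow[of "x [^] e"] by auto
qed

lemma normal_generate_singleton:
  assumes x: "x \<in> carrier G" and conj: "\<And>g. g \<in> carrier G \<Longrightarrow> g \<otimes> x \<otimes> inv g \<in> generate G {x}"
    and pos: "ord x > 0"
  shows "generate G {x} \<lhd> G"
proof -
  have sub: "subgroup (generate G {x}) G" using x generate_is_subgroup by simp
  interpret P: subgroup "generate G {x}" G by (rule sub)
  have "g \<otimes> h \<otimes> inv g \<in> generate G {x}" if g: "g \<in> carrier G" and h: "h \<in> generate G {x}" for g h
  proof -
    obtain k :: nat where k: "h = x [^] k" using h generate_eq_pow_image[OF x pos] by auto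
    have "(g \<otimes> x \<otimes> inv g) [^] k \<in> generate G {x}" using conj[OF g] by (induction k) auto
    then show ?thesis using conj_nat_pow[OF g x] k by simp
  qed
  then show ?thesis using sub normal_inv_iff by blast
qed

text \<open>The quotient is realised on coset representatives, so that its elements have the type of those
  of \<open>G\<close>; this is what makes an induction over the group order possible.\<close>

lemma quotient_same_type:
  assumes N: "N \<lhd> G"
  obtains H :: "'a monoid" and \<phi> where "group_hom G H \<phi>" "\<phi> ` carrier G = carrier H"
    "kernel G H \<phi> = N"
proof -
  interpret N: normal N G by (rule N)
  \<comment> \<open>The choice depends on the coset alone, so equal cosets get equal representatives
    (\<open>eqI\<close>).\<close>
  define \<rho> where "\<rho> g = (SOME x. x \<in> N #> g)" for g
  define H where "H = \<lparr>carrier = \<rho> ` carrier G, monoid.mult = (\<lambda>a b. \<rho> (a \<otimes> b)), one = \<rho> \<one>\<rparr>"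
  have mem: "\<rho> g \<in> N #> g" if "g \<in> carrier G" for g
    unfolding \<rho>_def using rcos_self[OF that N.subgroup_axioms] by (rule someI)
  have cos: "N #> \<rho> g = N #> g" if "g \<in> carrier G" for g
    using repr_independence[OF mem[OF that] that N.subgroup_axioms] by simp
  have cl: "\<rho> g \<in> carrier G" if "g \<in> carrier G" for g
    using mem[OF that] r_coset_subset_G[OF N.subset that] by blast
  have eqI: "\<rho> g = \<rho> h" if "N #> g = N #> h" for g h
    using that by (simp add: \<rho>_def)
  have mult: "\<rho> (\<rho> g \<otimes> \<rho> h) = \<rho> (g \<otimes> h)" if "g \<in> carrier G" "h \<in> carrier G" for g h
    using that by (intro eqI) (metis N.rcos_sum cl cos)
  have multl: "\<rho> (\<rho> g \<otimes> h) = \<rho> (g \<otimes> h)" if "g \<in> carrier G" "h \<in> carrier G" for g h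
    using that by (intro eqI) (metis N.rcos_sum cl cos)
  have multr: "\<rho> (g \<otimes> \<rho> h) = \<rho> (g \<otimes> h)" if "g \<in> carrier G" "h \<in> carrier G" for g h
    using that by (intro eqI) (metis N.rcos_sum cl cos)
  have "group H"
  proof (rule groupI)
    fix a assume "a \<in> carrier H"
    then obtain g where g: "g \<in> carrier G" "a = \<rho> g" by (auto simp: H_def)
    have "\<rho> (inv g) \<otimes>\<^bsub>H\<^esub> a = \<one>\<^bsub>H\<^esub>" using g by (simp add: H_def mult)
    then show "\<exists>b\<in>carrier H. b \<otimes>\<^bsub>H\<^esub> a = \<one>\<^bsub>H\<^esub>"
      by (rule bexI) (use g in \<open>simp add: H_def\<close>)
  qed (auto simp: H_def mult multl multr cl m_assoc)
  moreover have "\<rho> \<in> hom G H" by (auto simp: hom_def H_def mult)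
  ultimately have "group_hom G H \<rho>" by (simp add: group_hom_def group_hom_axioms_def is_group)
  moreover have "kernel G H \<rho> = N"
  proof -
    have "\<rho> g = \<rho> \<one> \<longleftrightarrow> g \<in> N" if "g \<in> carrier G" for g
    proof
      assume "\<rho> g = \<rho> \<one>"
      then have "N #> g = N #> \<one>" using cos that by (metis one_closed)
      then show "g \<in> N" using that N.subset rcos_self[OF that N.subgroup_axioms] by simp
    next
      assume "g \<in> N"
      then show "\<rho> g = \<rho> \<one>" using that N.subset
        by (intro eqI) (simp add: N.rcos_const[OF is_group] coset_mult_one)
    qed
    then show ?thesis using N.subset by (auto simp: kernel_def H_def)
  qed
  moreover have "\<rho> ` carrier G = carrier H" by (simp add: H_def)
  ultimately show ?thesis using that by blast
qed

lemma inv_comm_if_comm: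
  assumes "x \<in> carrier G" "a \<in> carrier G" "x \<otimes> a = a \<otimes> x"
  shows "x \<otimes> inv a = inv a \<otimes> x"
proof -
  have "x \<otimes> inv a = inv a \<otimes> (a \<otimes> x) \<otimes> inv a"
    using assms(1,2) by (simp add: m_assoc[symmetric])
  also have "\<dots> = inv a \<otimes> x"
    using assms(1,2) by (simp add: assms(3)[symmetric] m_assoc)
  finally show ?thesis .
qed

lemma commute_nat_pow:
  assumes "x \<in> carrier G" "g \<in> carrier G" "x \<otimes> g = g \<otimes> x [^] (r::nat)"
  shows "x [^] (i::nat) \<otimes> g = g \<otimes> x [^] (i * r)"
proof (induction i)
  case (Suc i)
  have "x [^] Suc i \<otimes> g = x [^] i \<otimes> g \<otimes> x [^] r"
    using assms by (simp add: m_assoc)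
  also have "\<dots> = g \<otimes> x [^] (Suc i * r)"
    using assms by (simp add: Suc.IH m_assoc nat_pow_mult add.commute)
  finally show ?case .
qed (use assms in simp)

text \<open>Moving a power of \<open>x\<close> to the right past one \<open>g\<close> multiplies its
  exponent by \<open>r\<close>. The copies of \<open>x [^] i\<close> pass 0, 1, ..., m - 1 factors
  \<open>g\<close>, whence the geometric sum.\<close>

lemma nat_pow_mult_twisted:
  assumes "x \<in> carrier G" "g \<in> carrier G" "x \<otimes> g = g \<otimes> x [^] (r::nat)"
  shows "(g \<otimes> x [^] (i::nat)) [^] (m::nat) = g [^] m \<otimes> x [^] (i * (\<Sum>t<m. r ^ t))"
proof (induction m)
  case (Suc m)
  let ?S = "\<Sum>t<m. r ^ t"
  have S: "(\<Sum>t<Suc m. r ^ t) = r * ?S + 1"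
    by (simp add: sum.lessThan_Suc_shift sum_distrib_left del: sum.lessThan_Suc)
  have "(g \<otimes> x [^] i) [^] Suc m = g [^] m \<otimes> (x [^] (i * ?S) \<otimes> g) \<otimes> x [^] i"
    using assms by (simp add: Suc.IH m_assoc)
  also have "\<dots> = g [^] Suc m \<otimes> x [^] (i * ?S * r + i)"
    using assms by (simp add: commute_nat_pow[OF assms] m_assoc nat_pow_mult)
  also have "i * ?S * r + i = i * (\<Sum>t<Suc m. r ^ t)"
    unfolding S by (simp add: algebra_simps)
  finally show ?case .
qed (use assms in simp)

lemma twisted_nat_pow:
  assumes "x \<in> carrier G" "g \<in> carrier G" "x \<otimes> g = g \<otimes> x [^] (r::nat)"
  shows "x \<otimes> g [^] (m::nat) = g [^] m \<otimes> x [^] (r ^ m)"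
proof (induction m)
  case (Suc m)
  have "x \<otimes> g [^] Suc m = g [^] m \<otimes> (x [^] (r ^ m) \<otimes> g)"
    using assms Suc.IH by (simp add: m_assoc[symmetric])
  also have "\<dots> = g [^] Suc m \<otimes> x [^] (r ^ Suc m)"
    using assms by (simp add: commute_nat_pow[OF assms] m_assoc[symmetric] mult.commute)
  finally show ?case .
qed (use assms in simp)

lemma ord_eq_mult_ord_pow:
  assumes "x \<in> carrier G" "m dvd ord x" "m > 0"
  shows "ord x = m * ord (x [^] m)"
  using assms by (simp add: ord_pow)

end

section \<open>Normal cyclic prime power subgroups\<close>

text \<open>\<open>H\<close> plays the role of G/P, where P is the normal cyclic Sylow
  \<open>p\<close>-subgroup generated by \<open>y\<close>. An abstract surjection is used in place
  of the factor group so that \<open>H\<close> can have a convenient carrier type.\<close>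

locale cyclic_prime_power_kernel = group_hom +
  fixes y p b
  assumes fin: "finite (carrier G)"
    and surj: "h ` carrier G = carrier H"
    and yG: "y \<in> carrier G"
    and ker: "kernel G H h = generate G {y}"
    and p: "prime p"
    and ord_y: "G.ord y = p ^ b"
    and cop: "coprime p (order H)"
begin

lemma fin_H: "finite (carrier H)"
  using fin surj by (metis finite_imageI)

lemma p_pos: "p > 0"
  using p prime_gt_0_nat by blast

lemma ord_y_pos: "G.ord y > 0"
  using ord_y p_pos by simp

lemma hom_y: "h y = \<one>\<^bsub>H\<^esub>"
  using ker generate.incl[of y "{y}" G] by (auto simp: kernel_def)

lemma hom_y_pow: "h (y [^] (i::nat)) = \<one>\<^bsub>H\<^esub>"
  using hom_y yG by (simp add: hom_nat_pow)

lemma kernel_pow: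
  assumes "g \<in> carrier G" "h g = \<one>\<^bsub>H\<^esub>"
  shows "\<exists>i. i < p ^ b \<and> g = y [^] i"
  using assms ker G.generate_eq_pow_image[OF yG ord_y_pos] by (auto simp: kernel_def ord_y)

lemma coprime_ord:
  assumes "x \<in> carrier H"
  shows "coprime (p ^ b) (H.ord x)" "\<not> p dvd H.ord x" "H.ord x > 0"
proof -
  have "coprime p (H.ord x)" using cop H.ord_dvd_group_order[OF assms] by (metis coprime_divisors dvd_refl)
  then show "coprime (p ^ b) (H.ord x)" "\<not> p dvd H.ord x"
    using p by (auto simp: coprime_absorb_left)
  show "H.ord x > 0" using H.ord_ge_1[OF fin_H assms] by simp
qed

lemma ord_hom_dvd:
  assumes "g \<in> carrier G"
  shows "H.ord (h g) dvd G.ord g"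
proof -
  have "h g [^]\<^bsub>H\<^esub> G.ord g = \<one>\<^bsub>H\<^esub>" using assms by (simp flip: hom_nat_pow)
  then show ?thesis using assms H.pow_eq_id by simp
qed

lemma twist:
  assumes "g \<in> carrier G"
  obtains r :: nat where "y \<otimes> g = g \<otimes> y [^] r"
proof -
  have "h (inv g \<otimes> y \<otimes> g) = \<one>\<^bsub>H\<^esub>" using assms yG hom_y by (simp add: hom_inv)
  then obtain r :: nat where "inv g \<otimes> y \<otimes> g = y [^] r"
    using assms yG kernel_pow[of "inv g \<otimes> y \<otimes> g"] by auto
  then have "g \<otimes> (inv g \<otimes> (y \<otimes> g)) = g \<otimes> y [^] r" using assms yG by (simp add: G.m_assoc)
  then have "y \<otimes> g = g \<otimes> y [^] r" using assms yG by (simp add: G.m_assoc[symmetric])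
  then show ?thesis using that by blast
qed

text \<open>Any preimage of \<open>x\<close> is raised to a power \<open>u\<close> that is 1 modulo
  the order of \<open>x\<close> and 0 modulo p^b: the image stays the same and the contribution of P
  is killed.\<close>

lemma lift_same_ord:
  assumes "x \<in> carrier H"
  obtains g where "g \<in> carrier G" "h g = x" "G.ord g = H.ord x"
proof -
  obtain g0 where g0: "g0 \<in> carrier G" "h g0 = x" using assms surj by (metis imageE)
  let ?m = "H.ord x"
  obtain u where u: "[u = 1] (mod ?m)" "[u = 0] (mod p ^ b)"
    using binary_chinese_remainder_nat[of ?m "p ^ b" 1 0] coprime_ord(1)[OF assms] by (auto simp: coprime_commute)
  define g where "g = g0 [^] u"
  have gG: "g \<in> carrier G" using g0 by (simp add: g_def)
  have "h g = x [^]\<^bsub>H\<^esub> (1::nat)"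
    unfolding g_def using g0 assms u H.pow_eq_iff_cong[OF assms] by (metis hom_nat_pow)
  then have hg: "h g = x" using assms by simp
  have "h (g0 [^] ?m) = \<one>\<^bsub>H\<^esub>" using g0 assms by (simp add: hom_nat_pow)
  then obtain i :: nat where i: "g0 [^] ?m = y [^] i"
    using g0 kernel_pow[of "g0 [^] ?m"] by auto
  obtain v where v: "u = p ^ b * v" using u(2) by (auto simp: cong_0_iff)
  have "g [^] ?m = (g0 [^] ?m) [^] u" using g0 by (simp add: g_def G.nat_pow_pow mult.commute)
  also have "\<dots> = (y [^] G.ord y) [^] (i * v)"
    using yG i v by (simp add: G.nat_pow_pow ord_y mult_ac)
  also have "\<dots> = \<one>" using yG by simp
  finally have "G.ord g dvd ?m" using gG G.pow_eq_id by simp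
  moreover have "?m dvd G.ord g" using ord_hom_dvd[OF gG] hg by simp
  ultimately show ?thesis using that gG hg dvd_antisym by blast
qed

lemma fibre_eq:
  assumes "g \<in> carrier G"
  shows "{w \<in> carrier G. h w = h g} = (\<lambda>i. g \<otimes> y [^] i) ` {..<p ^ b}"
proof
  show "(\<lambda>i. g \<otimes> y [^] i) ` {..<p ^ b} \<subseteq> {w \<in> carrier G. h w = h g}"
    using assms yG hom_y_pow by auto
  show "{w \<in> carrier G. h w = h g} \<subseteq> (\<lambda>i. g \<otimes> y [^] i) ` {..<p ^ b}"
  proof clarify
    fix w assume w: "w \<in> carrier G" "h w = h g"
    have "h (inv g \<otimes> w) = \<one>\<^bsub>H\<^esub>" using assms w by (simp add: hom_inv)
    then obtain i where i: "i < p ^ b" "inv g \<otimes> w = y [^] i"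
      using kernel_pow[of "inv g \<otimes> w"] assms w by auto
    have "w = g \<otimes> (inv g \<otimes> w)" using assms w by (simp add: G.m_assoc[symmetric])
    with i show "w \<in> (\<lambda>i. g \<otimes> y [^] i) ` {..<p ^ b}" by auto
  qed
qed

text \<open>The order m of the image divides the order of each g y^i, so that order is m times the
  order of (g y^i)^m. Because g^m = 1, the twisted power formula shows this m-th power to be a power
  of \<open>y\<close>.\<close>

lemma sum_ord_fibre:
  assumes g: "g \<in> carrier G" and twist: "y \<otimes> g = g \<otimes> y [^] (r::nat)" and og: "G.ord g = H.ord (h g)"
  shows "(\<Sum>w | w \<in> carrier G \<and> h w = h g. G.ord w) =
    (\<Sum>i<p ^ b. H.ord (h g) * G.ord (y [^] (i * (\<Sum>t<H.ord (h g). r ^ t))))"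
proof -
  let ?m = "H.ord (h g)"
  have hg: "h g \<in> carrier H" using g by simp
  have inj: "inj_on (\<lambda>i. g \<otimes> y [^] i) {..<p ^ b}"
    using G.inj_on_pow_lessThan_ord[OF yG] g yG by (auto simp: inj_on_def ord_y)
  have "G.ord (g \<otimes> y [^] i) = ?m * G.ord (y [^] (i * (\<Sum>t<?m. r ^ t)))" for i :: nat
  proof -
    have w: "g \<otimes> y [^] i \<in> carrier G" using g yG by simp
    have "h (g \<otimes> y [^] i) = h g" using g yG hom_y_pow by simp
    then have "?m dvd G.ord (g \<otimes> y [^] i)" using ord_hom_dvd[OF w] by simp
    then have "G.ord (g \<otimes> y [^] i) = ?m * G.ord ((g \<otimes> y [^] i) [^] ?m)"
      using G.ord_eq_mult_ord_pow[OF w] coprime_ord(3)[OF hg] by simp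
    also have "(g \<otimes> y [^] i) [^] ?m = y [^] (i * (\<Sum>t<?m. r ^ t))"
      using G.nat_pow_mult_twisted[OF yG g twist, of i ?m] g yG og by (metis G.l_one G.nat_pow_closed G.pow_ord_eq_1)
    finally show ?thesis .
  qed
  then show ?thesis
    unfolding fibre_eq[OF g] by (simp add: sum.reindex[OF inj])
qed

lemma sum_ord_fibre_commute:
  assumes g: "g \<in> carrier G" and comm: "y \<otimes> g = g \<otimes> y" and og: "G.ord g = H.ord (h g)"
  shows "(\<Sum>w | w \<in> carrier G \<and> h w = h g. G.ord w) = H.ord (h g) * cyc_psi (p ^ b)"
proof -
  let ?m = "H.ord (h g)"
  \<comment> \<open>With \<open>r = 1\<close> the geometric sum is \<open>?m\<close>; this is prime
    to \<open>p\<close>, so multiplying exponents by it preserves orders inside P.\<close>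
  have "G.ord (y [^] (i * ?m)) = G.ord (y [^] i)" for i :: nat
  proof -
    have "G.ord (y [^] i) dvd p ^ b" using yG ord_y by (metis G.nat_pow_closed G.nat_pow_one G.nat_pow_pow G.pow_eq_id G.pow_ord_eq_1 mult.commute)
    then have "coprime ?m (G.ord (y [^] i))"
      using coprime_ord(1)[of "h g"] g by (metis coprime_commute coprime_divisors dvd_refl hom_closed)
    then show ?thesis
      using G.pow_ord_eq_ord_iff[OF fin, of "y [^] i" ?m] yG by (simp add: G.nat_pow_pow)
  qed
  then have "(\<Sum>w | w \<in> carrier G \<and> h w = h g. G.ord w) = ?m * (\<Sum>i<p ^ b. G.ord (y [^] i))"
    using sum_ord_fibre[of g 1] assms yG by (simp add: sum_distrib_left)
  also have "(\<Sum>i<p ^ b. G.ord (y [^] i)) = cyc_psi (p ^ b)"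
    unfolding cyc_psi_def using yG by (intro sum.cong) (auto simp: G.ord_pow_gen ord_y)
  finally show ?thesis .
qed

text \<open>If \<open>y\<^sup>g = y\<^sup>r\<close> with \<open>r \<equiv> 1 (mod p)\<close>, then \<open>1 + r + \<dots> + r\<^sup>m\<^sup>-\<^sup>1 \<equiv> m\<close> is invertible and
  \<open>r\<^sup>m \<equiv> 1\<close> forces \<open>r \<equiv> 1\<close>; otherwise that sum vanishes modulo the order of \<open>y\<close>.\<close>

lemma sum_ord_fibre_not_commute:
  assumes g: "g \<in> carrier G" and comm: "y \<otimes> g \<noteq> g \<otimes> y" and og: "G.ord g = H.ord (h g)"
  shows "(\<Sum>w | w \<in> carrier G \<and> h w = h g. G.ord w) = H.ord (h g) * p ^ b"
proof -
  let ?m = "H.ord (h g)"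
  obtain r :: nat where r: "y \<otimes> g = g \<otimes> y [^] r" using twist[OF g] .
  let ?S = "\<Sum>t<?m. r ^ t"
  have "y [^] (r ^ ?m) = y [^] (1::nat)"
    using G.twisted_nat_pow[OF yG g r, of ?m] g yG og
    by (metis G.l_one G.nat_pow_closed G.pow_ord_eq_1 G.r_one G.nat_pow_eone)
  then have "[r ^ ?m = 1] (mod p ^ b)" using G.pow_eq_iff_cong[OF yG] ord_y by metis
  \<comment> \<open>Over the integers \<open>r - 1\<close> is a genuine difference even when
    \<open>r\<close> is 0.\<close>
  then have "[int (r ^ ?m) = 1] (mod int (p ^ b))"
    using cong_int_iff[of "r ^ ?m" 1 "p ^ b"] by simp
  then have dvd: "int (p ^ b) dvd (int r - 1) * int ?S"
    using power_diff_1_eq[of "int r" ?m] by (simp add: cong_iff_dvd_diff)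
  have ndvd: "\<not> int p dvd int r - 1"
  proof
    assume a: "int p dvd int r - 1"
    have "[(\<Sum>t<?m. int r ^ t) = (\<Sum>t<?m. 1)] (mod int p)"
      using a cong_pow[of "int r" 1 "int p"] by (intro cong_sum) (auto simp: cong_iff_dvd_diff)
    then have "[int ?S = int ?m] (mod int p)" by simp
    then have "\<not> int p dvd int ?S"
      using coprime_ord(2)[of "h g"] g by (metis cong_dvd_iff hom_closed int_dvd_int_iff)
    then have "coprime (int (p ^ b)) (int ?S)"
      using p by (metis coprime_int_iff coprime_power_left_iff int_dvd_int_iff prime_imp_coprime)
    then have "int (p ^ b) dvd int r - 1" using dvd coprime_dvd_mult_left_iff by blast
    then have "[r = 1] (mod G.ord y)"
      by (metis cong_iff_dvd_diff cong_int_iff ord_y of_nat_1)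
    then have "y [^] r = y [^] (1::nat)" using G.pow_eq_iff_cong[OF yG] by blast
    then show False using comm r yG by simp
  qed
  then have "coprime (int (p ^ b)) (int r - 1)"
    using p prime_imp_coprime[of "int p" "int r - 1"] by simp
  then have "p ^ b dvd ?S" using dvd by (metis coprime_dvd_mult_right_iff int_dvd_int_iff)
  then have "y [^] (i * ?S) = \<one>" for i :: nat
    using yG ord_y by (simp add: G.pow_eq_id)
  then show ?thesis using sum_ord_fibre[OF g r og] by simp
qed

text \<open>This is C_G(P)/P. As P is abelian, either all or none of the elements of a fibre commute
  with \<open>y\<close>, which is \<open>centralizing_iff\<close>.\<close>

definition centralizing :: "'c set"
  where "centralizing = h ` {g \<in> carrier G. y \<otimes> g = g \<otimes> y}"

lemma centralizing_iff:
  assumes "g \<in> carrier G"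
  shows "h g \<in> centralizing \<longleftrightarrow> y \<otimes> g = g \<otimes> y"
proof
  assume "h g \<in> centralizing"
  then obtain g' where g': "g' \<in> carrier G" "y \<otimes> g' = g' \<otimes> y" "h g = h g'"
    by (auto simp: centralizing_def)
  then obtain i :: nat where "g = g' \<otimes> y [^] i"
    using fibre_eq[OF g'(1)] assms by blast
  then show "y \<otimes> g = g \<otimes> y"
    using g' yG by (metis G.m_assoc G.nat_pow_Suc G.nat_pow_Suc2 G.nat_pow_closed)
qed (use assms in \<open>auto simp: centralizing_def\<close>)

lemma subgroup_centralizing: "subgroup centralizing H"
proof -
  have "subgroup {g \<in> carrier G. y \<otimes> g = g \<otimes> y} G"
  proof (rule G.subgroupI)
    fix a assume "a \<in> {g \<in> carrier G. y \<otimes> g = g \<otimes> y}"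
    then show "inv a \<in> {g \<in> carrier G. y \<otimes> g = g \<otimes> y}"
      using G.inv_comm_if_comm[OF yG, of a] by simp
  next
    fix a c assume "a \<in> {g \<in> carrier G. y \<otimes> g = g \<otimes> y}" "c \<in> {g \<in> carrier G. y \<otimes> g = g \<otimes> y}"
    then show "a \<otimes> c \<in> {g \<in> carrier G. y \<otimes> g = g \<otimes> y}"
      using yG by (simp add: G.m_assoc) (metis G.m_assoc)
  qed (use yG in auto)
  then show ?thesis unfolding centralizing_def by (rule subgroup_img_is_subgroup)
qed

text \<open>Orders are summed fibre by fibre over \<open>H\<close>; each fibre has a representative
  from \<open>lift_same_ord\<close>, to which one of the two fibre formulas applies.\<close>

lemma psi_eq:
  "psi G = cyc_psi (p ^ b) * (\<Sum>x\<in>centralizing. H.ord x) + p ^ b * (\<Sum>x\<in>carrier H - centralizing. H.ord x)"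
proof -
  let ?F = "\<lambda>x. \<Sum>w | w \<in> carrier G \<and> h w = x. G.ord w"
  have sub: "centralizing \<subseteq> carrier H" using subgroup_centralizing subgroup.subset by blast
  have "?F x = cyc_psi (p ^ b) * H.ord x" if x: "x \<in> centralizing" for x
  proof -
    obtain g where "g \<in> carrier G" "h g = x" "G.ord g = H.ord x"
      by (rule lift_same_ord[of x]) (use x sub in auto)
    then show ?thesis using sum_ord_fibre_commute[of g] x centralizing_iff[of g] by (auto simp: mult.commute)
  qed
  moreover have "?F x = p ^ b * H.ord x" if x: "x \<in> carrier H - centralizing" for x
  proof -
    obtain g where "g \<in> carrier G" "h g = x" "G.ord g = H.ord x"
      by (rule lift_same_ord[of x]) (use x in auto)
    then show ?thesis using sum_ord_fibre_not_commute[of g] x centralizing_iff[of g] by (auto simp: mult.commute)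
  qed
  moreover have "psi G = (\<Sum>x\<in>carrier H. ?F x)"
    unfolding psi_def by (rule sum.group[symmetric]) (use fin fin_H surj in auto)
  ultimately show ?thesis
    by (simp add: sum.subset_diff[OF sub fin_H] sum_distrib_left add.commute)
qed

end

section \<open>The extremal groups\<close>

lemma psi_iso:
  assumes "group G" "group H" "G \<cong> H"
  shows "psi G = psi H"
proof -
  interpret G: group G by fact
  interpret H: group H by fact
  obtain f where f: "f \<in> iso G H" using assms(3) by (auto simp: is_iso_def)
  then interpret f: group_hom G H f
    by (simp add: group_hom_def group_hom_axioms_def iso_imp_homomorphism)
  have bij: "bij_betw f (carrier G) (carrier H)" using f by (simp add: iso_def)
  have "H.ord (f x) = G.ord x" if x: "x \<in> carrier G" for x
  proof -
    have "f x [^]\<^bsub>H\<^esub> n = \<one>\<^bsub>H\<^esub> \<longleftrightarrow> x [^]\<^bsub>G\<^esub> n = \<one>\<^bsub>G\<^esub>" for n :: nat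
      using bij x by (metis G.nat_pow_closed G.one_closed bij_betw_def f.hom_nat_pow f.hom_one inj_on_eq_iff)
    then show ?thesis using x by (simp add: H.ord_unique G.pow_eq_id)
  qed
  then show ?thesis
    unfolding psi_def sum.reindex_bij_betw[OF bij, symmetric] by (intro sum.cong) auto
qed

lemma (in group) psi_cyclic:
  assumes "finite (carrier G)" "x \<in> carrier G" "ord x = order G"
  shows "psi G = cyc_psi (order G)"
proof -
  have "generate G {x} = carrier G"
    using assms by (intro card_subset_eq generate_incl) (auto simp: generate_pow_card[symmetric] order_def)
  then show ?thesis
    using sum_ord_generate[OF assms(2)] ord_ge_1[OF assms(1,2)] assms(3) by (simp add: psi_def)
qed

lemma carrier_cyc: "n > 0 \<Longrightarrow> carrier (cyc n) = {0..<int n}"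
  by (simp add: carrier_integer_mod_group)

lemma order_cyc: "n > 0 \<Longrightarrow> order (cyc n) = n"
  by (simp add: order_def carrier_cyc)

lemma psi_cyc:
  assumes "n > 0"
  shows "psi (cyc n) = cyc_psi n"
proof -
  interpret C: group "cyc n" by simp
  have x: "1 mod int n \<in> carrier (cyc n)" using assms by (simp add: carrier_cyc)
  have "C.ord (1 mod int n) = n"
    unfolding C.ord_unique[OF x] by (simp add: mod_mult_right_eq mod_eq_0_iff_dvd)
  then show ?thesis
    using C.psi_cyclic[OF _ x] assms by (simp add: order_cyc carrier_cyc)
qed

text \<open>The index of \<open>Z\<close> exceeds 1 and has a prime divisor \<open>l\<close>. The
  order of every element of \<open>Z\<close> then divides \<open>order G div l\<close>, so
  \<open>Z\<close> lies in the unique cyclic subgroup of index \<open>l\<close>.\<close>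

lemma (in group) sum_ord_proper_subgroup_cyclic:
  assumes fin: "finite (carrier G)" and x: "x \<in> carrier G" "ord x = order G"
    and Z: "subgroup Z G" "Z \<noteq> carrier G"
  obtains l where "prime l" "l dvd order G" "(\<Sum>z\<in>Z. ord z) \<le> cyc_psi (order G div l)"
proof -
  interpret Z: subgroup Z G by fact
  have pos: "order G > 0" using fin order_gt_0_iff_finite by blast
  obtain c where c: "order G = c * card Z" using lagrange[OF Z(1)] by metis
  have "c \<noteq> 1"
    using c Z(2) fin card_subset_eq[OF fin Z.subset] by (auto simp: order_def)
  then obtain l where l: "prime l" "l dvd c" using prime_factor_nat by blast
  then obtain c' where c': "c = l * c'" by auto
  have l0: "l > 0" using l prime_gt_0_nat by blast
  define e where "e = order G div l"
  have e: "order G = l * e" "e = c' * card Z" using l0 by (auto simp: e_def c c')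
  have e0: "e > 0" using e pos by auto
  have oe: "ord (x [^] l) = e" using x l0 e by (simp add: ord_pow)
  have xl: "x [^] l \<in> carrier G" using x by simp
  have "z \<in> generate G {x [^] l}" if z: "z \<in> Z" for z
  proof -
    have zG: "z \<in> carrier G" using z Z.subset by blast
    interpret GZ: group "G\<lparr>carrier := Z\<rparr>" using Z(1) by (rule subgroup_imp_group)
    have "z [^] card Z = \<one>"
      using GZ.pow_order_eq_1[of z] z by (simp add: order_def nat_pow_consistent[symmetric])
    then have "ord z dvd card Z" using zG pow_eq_id by simp
    then have "z [^] e = \<one>" using zG e pow_eq_id by simp
    moreover have "z \<in> generate G {x}"
      using zG x fin card_subset_eq[OF fin generate_incl[of "{x}"]] generate_pow_card[OF x(1)]
      by (auto simp: order_def)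
    ultimately show ?thesis
      using generate_mem_of_pow[of x e z] x pos e e0 by simp
  qed
  then have "Z \<subseteq> generate G {x [^] l}" by blast
  then have "(\<Sum>z\<in>Z. ord z) \<le> (\<Sum>z\<in>generate G {x [^] l}. ord z)"
    using fin generate_incl[of "{x [^] l}"] xl by (intro sum_mono2) (auto intro: finite_subset)
  also have "\<dots> = cyc_psi e" using sum_ord_generate[OF xl] oe e0 by simp
  finally show ?thesis using that[of l] l c e_def by simp
qed

lemma nat_pow_DirProd:
  "(a, b) [^]\<^bsub>G \<times>\<times> H\<^esub> (n::nat) = (a [^]\<^bsub>G\<^esub> n, b [^]\<^bsub>H\<^esub> n)"
  by (induction n) auto

lemma ord_DirProd:
  assumes "group G" "group H" "a \<in> carrier G" "b \<in> carrier H"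
  shows "group.ord (G \<times>\<times> H) (a, b) = lcm (group.ord G a) (group.ord H b)"
  using assms DirProd_group[OF assms(1,2)]
  by (simp add: group.ord_unique nat_pow_DirProd group.pow_eq_id)

lemma ord_cyc_prime:
  assumes "prime q" "i \<in> carrier (cyc q)"
  shows "group.ord (cyc q) i = (if i = 0 then 1 else q)"
proof -
  interpret C: group "cyc q" by simp
  have q: "q > 0" using assms prime_gt_0_nat by blast
  have "C.ord i dvd q" using C.ord_dvd_group_order[OF assms(2)] order_cyc[OF q] by simp
  moreover have "C.ord i = 1 \<longleftrightarrow> i = 0" using C.ord_eq_1[OF assms(2)] by simp
  ultimately show ?thesis using assms(1) by (metis prime_nat_iff)
qed

text \<open>Orders multiply across the coprime factors, and all \<open>q * q - 1\<close> nontrivial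
  elements of C_q x C_q have order \<open>q\<close>.\<close>

lemma psi_cyc_cyc_cyc:
  assumes q: "prime q" and k: "k > 0" "coprime q k"
  shows "psi (cyc q \<times>\<times> cyc q \<times>\<times> cyc k) = (1 + q * (q * q - 1)) * cyc_psi k"
proof -
  have q0: "q > 0" using q prime_gt_0_nat by blast
  interpret K: group "cyc k" by simp
  let ?Q = "carrier (cyc q)" and ?K = "carrier (cyc k)"
  define e where "e = (\<lambda>(i::int, j::int). if (i, j) = (0, 0) then 1 else q)"
  have ord: "group.ord (cyc q \<times>\<times> cyc q \<times>\<times> cyc k) (i, j, l) = e (i, j) * group.ord (cyc k) l"
    if "i \<in> ?Q" "j \<in> ?Q" "l \<in> ?K" for i j l
  proof -
    have "group.ord (cyc k) l dvd k" using K.ord_dvd_group_order[OF that(3)] order_cyc[OF k(1)] by simp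
    then have "coprime q (group.ord (cyc k) l)" using k(2) by (metis coprime_divisors dvd_refl)
    then have "lcm q (group.ord (cyc k) l) = q * group.ord (cyc k) l" by (simp add: lcm_coprime)
    then show ?thesis
      using that q by (simp add: ord_DirProd DirProd_group ord_cyc_prime e_def lcm.assoc[symmetric])
  qed
  have "psi (cyc q \<times>\<times> cyc q \<times>\<times> cyc k)
      = (\<Sum>i\<in>?Q. \<Sum>j\<in>?Q. \<Sum>l\<in>?K. e (i, j) * group.ord (cyc k) l)"
    by (auto simp: psi_def sum.cartesian_product ord intro!: sum.cong)
  also have "\<dots> = (\<Sum>x\<in>?Q \<times> ?Q. e x) * psi (cyc k)"
    by (simp add: psi_def sum.cartesian_product sum_distrib_left[symmetric] sum_distrib_right)
  also have "(\<Sum>x\<in>?Q \<times> ?Q. e x) = e (0, 0) + (\<Sum>x\<in>?Q \<times> ?Q - {(0, 0)}. e x)"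
    using q0 by (intro sum.remove) (auto simp: carrier_cyc)
  also have "(\<Sum>x\<in>?Q \<times> ?Q - {(0, 0)}. e x) = (\<Sum>x\<in>?Q \<times> ?Q - {(0, 0)}. q)"
    by (intro sum.cong) (auto simp: e_def split: if_splits)
  also have "\<dots> = q * (q * q - 1)"
    using q0 by (simp add: carrier_cyc card_Diff_subset card_cartesian_product)
  finally show ?thesis using psi_cyc[OF k(1)] by (simp add: e_def)
qed

section \<open>Internal description of C_q x C_q x C_k by commuting generators\<close>

lemma (in group) int_pow_hom_cyc:
  assumes "x \<in> carrier G" "ord x = n"
  shows "(\<lambda>i::int. x [^] i) \<in> hom (cyc n) G"
  using assms by (auto simp: hom_def int_pow_mult[symmetric] int_pow_eq mod_eq_dvd_iff[symmetric] dvd_minus_mod)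

lemma (in group) hom_DirProd_commuting:
  assumes f: "f \<in> hom A G" and g: "g \<in> hom B G"
    and comm: "\<And>x y. x \<in> carrier A \<Longrightarrow> y \<in> carrier B \<Longrightarrow> f x \<otimes> g y = g y \<otimes> f x"
  shows "(\<lambda>(x, y). f x \<otimes> g y) \<in> hom (A \<times>\<times> B) G"
proof (rule homI)
  fix u v assume "u \<in> carrier (A \<times>\<times> B)" "v \<in> carrier (A \<times>\<times> B)"
  then obtain a b c d where uv: "u = (a, b)" "v = (c, d)"
    "a \<in> carrier A" "b \<in> carrier B" "c \<in> carrier A" "d \<in> carrier B" by auto
  have cl: "f a \<in> carrier G" "f c \<in> carrier G" "g b \<in> carrier G" "g d \<in> carrier G"
    using uv f g by (auto simp: hom_def)
  have "f c \<otimes> (g b \<otimes> g d) = g b \<otimes> (f c \<otimes> g d)"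
    using cl comm[OF uv(5,4)] by (simp add: m_assoc[symmetric])
  then show "(case u \<otimes>\<^bsub>A \<times>\<times> B\<^esub> v of (x, y) \<Rightarrow> f x \<otimes> g y)
      = (case u of (x, y) \<Rightarrow> f x \<otimes> g y) \<otimes> (case v of (x, y) \<Rightarrow> f x \<otimes> g y)"
    using uv cl hom_mult[OF f uv(3,5)] hom_mult[OF g uv(4,6)] by (simp add: m_assoc)
qed (use f g in \<open>auto simp: hom_def\<close>)

text \<open>For prime \<open>q\<close> this is C_q x C_q x C_k in internal form
  (\<open>iso_elementary_times_cyclic\<close>). Commuting generators with prescribed orders can be
  lifted along a quotient map, which is awkward for an isomorphism.\<close>

definition elementary_times_cyclic :: "('a, 'b) monoid_scheme \<Rightarrow> nat \<Rightarrow> nat \<Rightarrow> bool"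
  where "elementary_times_cyclic G q k \<longleftrightarrow> order G = q * q * k \<and> coprime q k \<and>
    (\<exists>a\<in>carrier G. \<exists>b\<in>carrier G. \<exists>z\<in>carrier G.
      a \<otimes>\<^bsub>G\<^esub> b = b \<otimes>\<^bsub>G\<^esub> a \<and> a \<otimes>\<^bsub>G\<^esub> z = z \<otimes>\<^bsub>G\<^esub> a \<and> b \<otimes>\<^bsub>G\<^esub> z = z \<otimes>\<^bsub>G\<^esub> b \<and>
      group.ord G a = q \<and> group.ord G b = q \<and> group.ord G z = k \<and> b \<notin> generate G {a})"

lemma elementary_times_cyclicI:
  assumes "order G = q * q * k" "coprime q k" "a \<in> carrier G" "b \<in> carrier G" "z \<in> carrier G"
    "a \<otimes>\<^bsub>G\<^esub> b = b \<otimes>\<^bsub>G\<^esub> a" "a \<otimes>\<^bsub>G\<^esub> z = z \<otimes>\<^bsub>G\<^esub> a" "b \<otimes>\<^bsub>G\<^esub> z = z \<otimes>\<^bsub>G\<^esub> b"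
    "group.ord G a = q" "group.ord G b = q" "group.ord G z = k" "b \<notin> generate G {a}"
  shows "elementary_times_cyclic G q k"
  unfolding elementary_times_cyclic_def using assms by blast

lemma (in group) int_pow_comm:
  assumes "x \<in> carrier G" "y \<in> carrier G" "x \<otimes> y = y \<otimes> x"
  shows "x [^] (i::int) \<otimes> y [^] (j::int) = y [^] j \<otimes> x [^] i"
proof -
  have *: "u \<otimes> v [^] j = v [^] j \<otimes> u" if "u \<in> carrier G" "v \<in> carrier G" "u \<otimes> v = v \<otimes> u" for u v and j :: int
  proof -
    have n: "u \<otimes> v [^] n = v [^] n \<otimes> u" for n :: nat
      using commute_nat_pow[of v u 1 n] that by simp
    then show ?thesis
      using inv_comm_if_comm[OF that(1) nat_pow_closed[OF that(2)] n]
      by (simp only: int_pow_def2 split: if_split) blast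
  qed
  show ?thesis using *[of "x [^] i" y] *[of y x] assms by simp
qed

text \<open>Sending (i, j, l) to a^i b^j z^l is a homomorphism because the generators commute. Its
  kernel is trivial and both groups have the same order, so it is bijective.\<close>

lemma (in group) iso_elementary_times_cyclic:
  assumes fin: "finite (carrier G)" and q: "prime q" and e: "elementary_times_cyclic G q k"
  shows "G \<cong> cyc q \<times>\<times> cyc q \<times>\<times> cyc k"
proof -
  have ord_G: "order G = q * q * k" and cop: "coprime q k"
    using e by (auto simp: elementary_times_cyclic_def)
  obtain a b z where abz: "a \<in> carrier G" "b \<in> carrier G" "z \<in> carrier G"
      "a \<otimes> b = b \<otimes> a" "a \<otimes> z = z \<otimes> a" "b \<otimes> z = z \<otimes> b"
      "ord a = q" "ord b = q" "ord z = k" "b \<notin> generate G {a}"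
    using e unfolding elementary_times_cyclic_def by blast
  have q0: "q > 0" using q prime_gt_0_nat by blast
  have k0: "k > 0" using ord_ge_1[OF fin abz(3)] abz by simp
  let ?C = "cyc q \<times>\<times> cyc q \<times>\<times> cyc k"
  let ?g = "\<lambda>(j::int, l::int). b [^] j \<otimes> z [^] l"
  let ?f = "\<lambda>(i::int, x). a [^] i \<otimes> ?g x"
  have g: "?g \<in> hom (cyc q \<times>\<times> cyc k) G"
    using abz by (intro hom_DirProd_commuting int_pow_hom_cyc int_pow_comm) auto
  have f: "?f \<in> hom ?C G"
  proof (rule hom_DirProd_commuting)
    fix i x assume "i \<in> carrier (cyc q)" "x \<in> carrier (cyc q \<times>\<times> cyc k)"
    obtain j l where x: "x = (j, l)" by (cases x)
    have "a [^] i \<otimes> (b [^] j \<otimes> z [^] l) = b [^] j \<otimes> (a [^] i \<otimes> z [^] l)"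
      using abz int_pow_comm[of a b i j] by (simp add: m_assoc[symmetric])
    also have "\<dots> = b [^] j \<otimes> z [^] l \<otimes> a [^] i"
      using abz int_pow_comm[of a z i l] by (simp add: m_assoc)
    finally show "a [^] i \<otimes> ?g x = ?g x \<otimes> a [^] i" by (simp add: x)
  qed (use g abz int_pow_hom_cyc in auto)
  interpret f: group_hom ?C G ?f
    using f by (simp add: group_hom_def group_hom_axioms_def DirProd_group is_group)
  have "kernel ?C G ?f \<subseteq> {\<one>\<^bsub>?C\<^esub>}"
  proof
    fix w assume "w \<in> kernel ?C G ?f"
    then obtain i j l where w: "w = (i, j, l)" "i \<in> carrier (cyc q)" "j \<in> carrier (cyc q)"
        "l \<in> carrier (cyc k)" "a [^] i \<otimes> (b [^] j \<otimes> z [^] l) = \<one>"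
      by (auto simp: kernel_def)
    have rng: "0 \<le> i" "i < q" "0 \<le> j" "j < q" "0 \<le> l" "l < k"
      using w q0 k0 by (auto simp: carrier_cyc)
    let ?u = "a [^] i \<otimes> b [^] j"
    have comm_ab: "a [^] i \<otimes> b [^] j = b [^] j \<otimes> a [^] i" using int_pow_comm abz by simp
    have uz: "?u \<otimes> z [^] l = \<one>" using w abz by (simp add: m_assoc)
    have "z [^] l = inv ?u" using uz abz by (metis inv_equality inv_inv int_pow_closed m_closed)
    \<comment> \<open>A kernel element makes z^l the inverse of \<open>?u\<close>, so its order
      divides both \<open>q\<close> and \<open>k\<close>; these are coprime, hence
      \<open>l = 0\<close>.\<close>
    moreover have "?u [^] q = \<one>"
      using pow_mult_distrib[OF comm_ab] abz int_pow_pow[of a i "int q"] int_pow_pow[of b j "int q"]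
        int_pow_eq_id[of a "i * int q"] int_pow_eq_id[of b "j * int q"]
      by (simp add: int_pow_int[symmetric])
    ultimately have "(z [^] l) [^] q = \<one>" using abz by (simp add: nat_pow_inv)
    then have "z [^] (l * int q) = \<one>"
      using int_pow_pow[of z l "int q"] abz by (simp add: int_pow_int)
    then have "int k dvd l * int q" using abz int_pow_eq_id by simp
    then have "int k dvd l"
      using cop by (metis coprime_commute coprime_dvd_mult_left_iff coprime_int_iff)
    then have l: "l = 0" using rng by (metis zdvd_not_zless order_less_le)
    then have ab: "a [^] i \<otimes> b [^] j = \<one>" using uz abz by simp
    \<comment> \<open>Otherwise \<open>j\<close> is invertible modulo \<open>q\<close>, and Bezout
      writes \<open>b\<close> as a power of b^j = a^(-i), contrary to the choice of \<open>b\<close>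
      outside the subgroup of \<open>a\<close>.\<close>
    have j: "j = 0"
    proof (rule ccontr)
      assume "j \<noteq> 0"
      then have "\<not> int q dvd j" using rng zdvd_not_zless by fastforce
      then have "coprime (int q) j" using q prime_imp_coprime[of "int q" j] by simp
      then obtain u v where uv: "u * j + v * int q = 1"
        using bezout_int[of j "int q"] by (auto simp: coprime_iff_gcd_eq_1 gcd.commute)
      have bj: "b [^] j \<in> generate G {a}"
      proof -
        have "b [^] j = inv (a [^] i)" using ab comm_ab abz by (metis inv_equality int_pow_closed)
        also have "\<dots> = a [^] (- i)" using abz by (simp add: int_pow_neg)
        finally show ?thesis using generate_pow abz by blast
      qed
      have "b = b [^] (j * u)"
        using int_pow_eq[of b 1 "j * u"] uv abz
        by (metis add_diff_cancel_left' diff_add_cancel dvd_minus_iff dvd_triv_right int_pow_1 minus_diff_eq mult.commute add.commute)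
      also have "\<dots> = (b [^] j) [^] u" using abz by (simp add: int_pow_pow)
      finally have "b = (b [^] j) [^] u" .
      moreover have "(b [^] j) [^] u \<in> generate G {a}"
        using subgroup_int_pow_closed[OF generate_is_subgroup bj] abz by simp
      ultimately show False using abz by metis
    qed
    have "int q dvd i" using ab j abz int_pow_eq_id by simp
    then have "i = 0" using rng by (metis zdvd_not_zless order_less_le)
    then show "w \<in> {\<one>\<^bsub>?C\<^esub>}" using w j l by simp
  qed
  then have inj: "inj_on ?f (carrier ?C)"
    using f.inj_iff_trivial_ker f.hom_one f.G.one_closed unfolding kernel_def by blast
  have "card (carrier ?C) = card (carrier G)"
    using ord_G q0 k0 by (simp add: order_def carrier_cyc card_cartesian_product)
  then have "card (?f ` carrier ?C) = card (carrier G)" using card_image[OF inj] by simp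
  moreover have "?f ` carrier ?C \<subseteq> carrier G" using f.hom_closed by blast
  ultimately have "?f ` carrier ?C = carrier G" using card_subset_eq[OF fin] by blast
  then have "?f \<in> iso ?C G" using f inj by (simp add: iso_def bij_betw_def)
  then have "?C \<cong> G" unfolding is_iso_def by blast
  then show ?thesis by (rule f.G.iso_sym)
qed

section \<open>Products of coprime order, a bound from the largest order, and groups of prime square
  order\<close>

context group
begin

lemma ord_mult_coprime:
  assumes x: "x \<in> carrier G" and y: "y \<in> carrier G" and comm: "x \<otimes> y = y \<otimes> x"
    and cop: "coprime (ord x) (ord y)"
  shows "ord (x \<otimes> y) = ord x * ord y"
proof (rule dvd_antisym)
  have *: "ord u dvd ord (u \<otimes> v)"
    if u: "u \<in> carrier G" and v: "v \<in> carrier G" and uv: "u \<otimes> v = v \<otimes> u" and c: "coprime (ord u) (ord v)"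
    for u v
  proof -
    let ?n = "ord (u \<otimes> v) * ord v"
    have "(u \<otimes> v) [^] ?n = \<one>" using u v by (simp add: pow_eq_id)
    then have "u [^] ?n \<otimes> v [^] ?n = \<one>" using pow_mult_distrib[OF uv u v] by simp
    moreover have "v [^] ?n = \<one>" using v by (simp add: pow_eq_id)
    ultimately have "ord u dvd ?n" using u by (simp add: pow_eq_id)
    then show ?thesis using c coprime_dvd_mult_left_iff by blast
  qed
  show "ord x * ord y dvd ord (x \<otimes> y)"
    using *[OF x y comm cop] *[OF y x comm[symmetric]] cop comm
    by (simp add: divides_mult coprime_commute)
  show "ord (x \<otimes> y) dvd ord x * ord y" by (rule ord_mul_divides[OF comm x y])
qed

text \<open>The subgroup generated by \<open>x\<close> contributes its exact order sum; only the
  elements outside it are estimated by the maximal order.\<close>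

lemma psi_le_max_ord:
  assumes fin: "finite (carrier G)" and x: "x \<in> carrier G" "\<And>w. w \<in> carrier G \<Longrightarrow> ord w \<le> ord x"
  shows "psi G \<le> cyc_psi (ord x) + (order G - ord x) * ord x"
proof -
  have sub: "generate G {x} \<subseteq> carrier G" using x(1) generate_incl by simp
  have "psi G = (\<Sum>w\<in>generate G {x}. ord w) + (\<Sum>w\<in>carrier G - generate G {x}. ord w)"
    unfolding psi_def using sum.subset_diff[OF sub fin] by (simp add: add.commute)
  also have "(\<Sum>w\<in>generate G {x}. ord w) = cyc_psi (ord x)"
    using sum_ord_generate[OF x(1)] ord_ge_1[OF fin x(1)] by simp
  also have "(\<Sum>w\<in>carrier G - generate G {x}. ord w) \<le> (\<Sum>w\<in>carrier G - generate G {x}. ord x)"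
    using x(2) by (intro sum_mono) auto
  also have "\<dots> = (order G - ord x) * ord x"
    using card_Diff_subset[OF finite_subset[OF sub fin] sub] generate_pow_card[OF x(1)]
    by (simp add: order_def)
  finally show ?thesis by simp
qed

text \<open>All nontrivial elements have order \<open>p\<close>. A subgroup generated by
  \<open>x\<close> has index \<open>p\<close>, so by \<open>conj_mem_small_index\<close> any outside
  element \<open>g\<close> acts on it as x -> x^r. Then r^p = 1 modulo \<open>p\<close>, while
  Fermat gives r^p = r, so \<open>r\<close> is 1 and \<open>x\<close>, \<open>g\<close>
  commute.\<close>

lemma elementary_times_cyclic_prime_square:
  assumes fin: "finite (carrier G)" and p: "prime p" and ord_G: "order G = p * p"
    and nc: "\<not> cyclic_group G"
  shows "elementary_times_cyclic G p 1"
proof -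
  have p0: "p > 1" using p prime_gt_1_nat by blast
  have ord_p: "ord w = p" if w: "w \<in> carrier G" "w \<noteq> \<one>" for w
  proof -
    have "ord w dvd p ^ 2" using ord_dvd_group_order[OF w(1)] ord_G by (simp add: power2_eq_square)
    then obtain i where i: "i \<le> 2" "ord w = p ^ i" using divides_primepow_nat[OF p] by blast
    have "i \<noteq> 0" using i w ord_eq_1 by (metis power_0)
    moreover have "i \<noteq> 2" using i nc ord_G w(1) cyclic_group_iff_ord[OF fin] by (metis power2_eq_square)
    ultimately have "i = 1" using i by linarith
    then show ?thesis using i by simp
  qed
  have ex: "\<exists>w. w \<in> carrier G - S" if "S \<subseteq> carrier G" "card S < p * p" for S
    using that ord_G fin by (metis card_mono Diff_eq_empty_iff all_not_in_conv finite_subset leD order_def)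
  obtain x where x: "x \<in> carrier G" "x \<noteq> \<one>" using ex[of "{\<one>}"] less_1_mult[OF p0 p0] by auto
  have ox: "ord x = p" using ord_p x by simp
  have cx: "card (generate G {x}) = p" using generate_pow_card[OF x(1)] ox by simp
  obtain g where g: "g \<in> carrier G" "g \<notin> generate G {x}"
    using ex[of "generate G {x}"] generate_incl[of "{x}"] x cx p0 by auto
  have "g \<noteq> \<one>" using g generate.one by metis
  then have og: "ord g = p" using ord_p g by simp
  have "inv g \<otimes> x \<otimes> inv (inv g) \<in> generate G {x}"
    using generate_is_subgroup[of "{x}"] generate.incl[of x "{x}" G] x g p ox ord_G cx
    by (intro conj_mem_small_index[OF fin, of _ _ p 1]) auto
  then obtain r :: nat where r: "inv g \<otimes> x \<otimes> g = x [^] r"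
    using generate_eq_pow_image[OF x(1)] ox p0 g by auto
  have "x \<otimes> g = g \<otimes> (inv g \<otimes> x \<otimes> g)" using x g by (simp add: m_assoc[symmetric])
  then have tw: "x \<otimes> g = g \<otimes> x [^] r" using r by simp
  have "x [^] (1::nat) = x [^] (r ^ p)"
    using twisted_nat_pow[OF x(1) g(1) tw, of p] x g og pow_ord_eq_1[OF g(1)] by simp
  then have rp: "[r ^ p = 1] (mod p)" using pow_eq_iff_cong[OF x(1)] ox by (metis cong_sym)
  have "\<not> p dvd r"
  proof
    assume "p dvd r"
    then have "p dvd r ^ p" using p0 by (simp add: dvd_power_iff dvd_trans)
    then have "p dvd 1" using rp cong_dvd_iff by blast
    then show False using p0 by simp
  qed
  then have "[r ^ (p - 1) = 1] (mod p)" using fermat_theorem p by blast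
  then have "[r ^ (p - 1) * r = 1 * r] (mod p)" by (rule cong_scalar_right)
  then have "[r ^ p = r] (mod p)" using p0 by (metis Suc_diff_1 gr_implies_not0 mult_1 neq0_conv power_Suc2)
  then have "[r = 1] (mod p)" using rp by (metis cong_sym cong_trans)
  then have "x [^] r = x [^] (1::nat)" using pow_eq_iff_cong[OF x(1)] ox by metis
  then have "x \<otimes> g = g \<otimes> x" using tw x by simp
  then show ?thesis
    by (intro elementary_times_cyclicI[of G p _ x g \<one>]) (use x g ox og ord_G in auto)
qed

end

section \<open>Comparing G with its quotient by a normal cyclic Sylow subgroup\<close>

context cyclic_prime_power_kernel
begin

lemma order_eq: "order G = p ^ b * order H"
proof -
  have "card {w \<in> carrier G. h w = x} = p ^ b" if x: "x \<in> carrier H" for x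
  proof -
    obtain g where g: "g \<in> carrier G" "h g = x" using x surj by (metis imageE)
    have "inj_on (\<lambda>i. g \<otimes> y [^] i) {..<p ^ b}"
      using G.inj_on_pow_lessThan_ord[OF yG] g yG by (auto simp: inj_on_def ord_y)
    then show ?thesis using fibre_eq[OF g(1)] g(2) by (simp add: card_image)
  qed
  moreover have "order G = (\<Sum>x\<in>carrier H. card {w \<in> carrier G. h w = x})"
    using sum.group[of "carrier G" "carrier H" h "\<lambda>_. 1::nat"] fin fin_H surj by (simp add: order_def)
  ultimately show ?thesis by (simp add: order_def)
qed

text \<open>The commutator of \<open>u\<close> and \<open>v\<close> is a central power of \<open>y\<close> whose order divides that of \<open>u\<close>.\<close>

lemma commute_lift:
  assumes central: "centralizing = carrier H" and u: "u \<in> carrier G" and v: "v \<in> carrier G"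
    and comm: "h u \<otimes>\<^bsub>H\<^esub> h v = h v \<otimes>\<^bsub>H\<^esub> h u" and cop_u: "coprime p (G.ord u)"
  shows "u \<otimes> v = v \<otimes> u"
proof -
  let ?n = "G.ord u"
  have "h (inv u \<otimes> (inv v \<otimes> u \<otimes> v)) = inv\<^bsub>H\<^esub> h u \<otimes>\<^bsub>H\<^esub> (inv\<^bsub>H\<^esub> h v \<otimes>\<^bsub>H\<^esub> (h u \<otimes>\<^bsub>H\<^esub> h v))"
    using u v by (simp add: hom_inv H.m_assoc)
  also have "inv\<^bsub>H\<^esub> h v \<otimes>\<^bsub>H\<^esub> (h u \<otimes>\<^bsub>H\<^esub> h v) = h u"
    unfolding comm using u v by (simp add: H.m_assoc[symmetric])
  finally have "h (inv u \<otimes> (inv v \<otimes> u \<otimes> v)) = \<one>\<^bsub>H\<^esub>" using u by simp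
  then obtain i :: nat where i: "inv u \<otimes> (inv v \<otimes> u \<otimes> v) = y [^] i"
    using kernel_pow[of "inv u \<otimes> (inv v \<otimes> u \<otimes> v)"] u v by auto
  have "inv v \<otimes> u \<otimes> v = u \<otimes> (inv u \<otimes> (inv v \<otimes> u \<otimes> v))"
    using u v by (simp add: G.m_assoc[symmetric])
  then have c: "inv v \<otimes> u \<otimes> v = u \<otimes> y [^] i" using i by simp
  have "y \<otimes> u = u \<otimes> y" using centralizing_iff[OF u] central u by simp
  then have yu: "u \<otimes> y [^] i = y [^] i \<otimes> u"
    using G.commute_nat_pow[OF yG u, of 1 i] yG by simp
  have "(inv v \<otimes> u \<otimes> v) [^] ?n = \<one>"
    using G.conj_nat_pow[of "inv v" u ?n] u v by simp
  then have "u [^] ?n \<otimes> (y [^] i) [^] ?n = \<one>"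
    unfolding c using G.pow_mult_distrib[OF yu] u yG by simp
  then have "p ^ b dvd i * ?n" using u yG by (simp add: G.nat_pow_pow G.pow_eq_id ord_y)
  then have "p ^ b dvd i" using cop_u by (simp add: coprime_dvd_mult_left_iff)
  then have "y [^] i = \<one>" using yG by (simp add: G.pow_eq_id ord_y)
  then have "inv v \<otimes> u \<otimes> v = u" using c u by simp
  then have "v \<otimes> (inv v \<otimes> u \<otimes> v) = v \<otimes> u" by simp
  then show ?thesis using u v by (simp add: G.m_assoc[symmetric])
qed

text \<open>The generators are lifted with their orders. In each pair to be checked one member has
  order \<open>q\<close>, prime to \<open>p\<close>, so \<open>commute_lift\<close> applies.
  Multiplying the third lift by the central \<open>y\<close> yields order k p^b.\<close>

lemma elementary_times_cyclic_lift:
  assumes central: "centralizing = carrier H" and e: "elementary_times_cyclic H q k"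
    and q: "prime q" "q \<noteq> p"
  shows "elementary_times_cyclic G q (k * p ^ b)"
proof -
  have ord_H: "order H = q * q * k" and cop_k: "coprime q k"
    using e by (auto simp: elementary_times_cyclic_def)
  obtain a' b' z' where abz': "a' \<in> carrier H" "b' \<in> carrier H" "z' \<in> carrier H"
      "a' \<otimes>\<^bsub>H\<^esub> b' = b' \<otimes>\<^bsub>H\<^esub> a'" "a' \<otimes>\<^bsub>H\<^esub> z' = z' \<otimes>\<^bsub>H\<^esub> a'" "b' \<otimes>\<^bsub>H\<^esub> z' = z' \<otimes>\<^bsub>H\<^esub> b'"
      "H.ord a' = q" "H.ord b' = q" "H.ord z' = k" "b' \<notin> generate H {a'}"
    using e unfolding elementary_times_cyclic_def by blast
  obtain a where a: "a \<in> carrier G" "h a = a'" "G.ord a = q"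
    using lift_same_ord[OF abz'(1)] abz'(7) by metis
  obtain c where c: "c \<in> carrier G" "h c = b'" "G.ord c = q"
    using lift_same_ord[OF abz'(2)] abz'(8) by metis
  obtain z where z: "z \<in> carrier G" "h z = z'" "G.ord z = k"
    using lift_same_ord[OF abz'(3)] abz'(9) by metis
  have pq: "coprime p q" using primes_coprime[OF p q(1)] q(2) by simp
  have ac: "a \<otimes> c = c \<otimes> a" by (rule commute_lift[OF central]) (use a c abz' pq in simp_all)
  have az: "a \<otimes> z = z \<otimes> a" by (rule commute_lift[OF central]) (use a z abz' pq in simp_all)
  have cz: "c \<otimes> z = z \<otimes> c" by (rule commute_lift[OF central]) (use c z abz' pq in simp_all)
  have ycomm: "y \<otimes> g = g \<otimes> y" if "g \<in> carrier G" for g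
    using centralizing_iff[OF that] central that by simp
  have "coprime p k" using cop ord_H by simp
  then have "G.ord (z \<otimes> y) = k * p ^ b"
    using G.ord_mult_coprime[OF z(1) yG] ycomm[OF z(1)] z(3) ord_y by (simp add: coprime_commute)
  moreover have "a \<otimes> (z \<otimes> y) = z \<otimes> y \<otimes> a"
  proof -
    have "a \<otimes> (z \<otimes> y) = z \<otimes> (a \<otimes> y)" using az a z yG by (simp add: G.m_assoc[symmetric])
    then show ?thesis using ycomm[OF a(1)] a z yG by (simp add: G.m_assoc)
  qed
  moreover have "c \<otimes> (z \<otimes> y) = z \<otimes> y \<otimes> c"
  proof -
    have "c \<otimes> (z \<otimes> y) = z \<otimes> (c \<otimes> y)" using cz c z yG by (simp add: G.m_assoc[symmetric])
    then show ?thesis using ycomm[OF c(1)] c z yG by (simp add: G.m_assoc)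
  qed
  moreover have "c \<notin> generate G {a}"
  proof
    assume "c \<in> generate G {a}"
    then obtain i :: int where "c = a [^] i" using G.generate_pow[OF a(1)] by auto
    then have "b' = a' [^]\<^bsub>H\<^esub> i" using a c by (metis hom_int_pow)
    then show False using abz' H.generate_pow[OF abz'(1)] by auto
  qed
  moreover have "order G = q * q * (k * p ^ b)" using order_eq ord_H by simp
  moreover have "coprime q (k * p ^ b)" using cop_k pq by (simp add: coprime_commute)
  ultimately show ?thesis
    by (intro elementary_times_cyclicI[of G q _ a c "z \<otimes> y"]) (use a c z yG ac in auto)
qed

text \<open>Since |P| < psi(P), every element of \<open>H\<close> outside
  \<open>centralizing\<close> makes the sum in \<open>psi_eq\<close> strictly smaller than the
  product.\<close>

lemma psi_le:
  assumes "b > 0"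
  shows "psi G \<le> cyc_psi (p ^ b) * psi H"
    and "psi G = cyc_psi (p ^ b) * psi H \<Longrightarrow> centralizing = carrier H"
proof -
  let ?S = "\<Sum>x\<in>centralizing. H.ord x" and ?T = "\<Sum>x\<in>carrier H - centralizing. H.ord x"
  have sub: "centralizing \<subseteq> carrier H" using subgroup_centralizing subgroup.subset by blast
  have psi_H: "psi H = ?S + ?T"
    unfolding psi_def using sum.subset_diff[OF sub fin_H] by (simp add: add.commute)
  obtain r where r: "p = Suc (Suc r)"
    using p prime_ge_2_nat by (metis Suc_le_D numeral_2_eq_2 Suc_le_mono)
  have "(p * (p - 1) + 1) * p ^ b \<le> p * cyc_psi (p ^ b)" by (rule prime_power_le_cyc_psi[OF p assms])
  moreover have "p * p ^ b < (p * (p - 1) + 1) * p ^ b"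
    by (rule mult_strict_right_mono) (simp_all add: r)
  ultimately have "p * p ^ b < p * cyc_psi (p ^ b)" by linarith
  then have lt: "p ^ b < cyc_psi (p ^ b)" by simp
  then have le: "p ^ b * ?T \<le> cyc_psi (p ^ b) * ?T" by simp
  then show "psi G \<le> cyc_psi (p ^ b) * psi H" by (simp add: psi_eq psi_H distrib_left)
  assume "psi G = cyc_psi (p ^ b) * psi H"
  then have "p ^ b * ?T = cyc_psi (p ^ b) * ?T" by (simp add: psi_eq psi_H distrib_left)
  then have "?T = 0" using lt by simp
  then have "\<forall>x\<in>carrier H - centralizing. H.ord x = 0" using fin_H by simp
  then have "carrier H - centralizing = {}"
    using H.ord_ge_1[OF fin_H] by (metis DiffD1 ex_in_conv not_one_le_zero)
  then show "centralizing = carrier H" using sub by blast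
qed

text \<open>If P were central, a lifted generator of \<open>H\<close> times \<open>y\<close> would
  have order |G|. So \<open>centralizing\<close> is a proper subgroup of the cyclic group
  \<open>H\<close>, and \<open>S\<close>, its share of the order sum, is small.\<close>

lemma psi_cyclic_quotient:
  assumes cyc_H: "cyclic_group H" and nc: "\<not> cyclic_group G"
  obtains S T l where "psi G = cyc_psi (p ^ b) * S + p ^ b * T" "S + T = cyc_psi (order H)"
    "prime l" "l dvd order H" "(l * (l - 1) + 1) * S \<le> cyc_psi (order H)"
proof -
  let ?S = "\<Sum>x\<in>centralizing. H.ord x" and ?T = "\<Sum>x\<in>carrier H - centralizing. H.ord x"
  have sub: "centralizing \<subseteq> carrier H" using subgroup_centralizing subgroup.subset by blast
  obtain x where x: "x \<in> carrier H" "H.ord x = order H" using cyc_H H.cyclic_group_iff_ord[OF fin_H] by blast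
  have ST: "?S + ?T = cyc_psi (order H)"
    using H.psi_cyclic[OF fin_H x] sum.subset_diff[OF sub fin_H, of H.ord] by (simp add: psi_def)
  have "centralizing \<noteq> carrier H"
  proof
    assume a: "centralizing = carrier H"
    obtain g where g: "g \<in> carrier G" "h g = x" "G.ord g = order H"
      using lift_same_ord[OF x(1)] x(2) by metis
    have "g \<otimes> y = y \<otimes> g" using centralizing_iff[OF g(1)] a g x by simp
    then have "G.ord (g \<otimes> y) = order G"
      using G.ord_mult_coprime[OF g(1) yG] g(3) cop ord_y order_eq
      by (simp add: coprime_commute mult.commute)
    then show False using nc G.cyclic_group_iff_ord[OF fin] g yG by blast
  qed
  then obtain l where l: "prime l" "l dvd order H" "?S \<le> cyc_psi (order H div l)"
    using H.sum_ord_proper_subgroup_cyclic[OF fin_H x subgroup_centralizing] by metis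
  have "order H > 0" using fin_H H.order_gt_0_iff_finite by blast
  then have "(l * (l - 1) + 1) * ?S \<le> cyc_psi (order H)"
    using cyc_psi_div_prime[OF l(1,2)] mult_le_mono2[OF l(3), of "l * (l - 1) + 1"] by linarith
  then show ?thesis using that psi_eq ST l by blast
qed

end

section \<open>The bounds\<close>

text \<open>The bound M / D with denominators cleared. The equality clause is one implication only;
  its converse is a direct computation in \<open>psi_ratio\<close>.\<close>

definition psi_bound :: "('a, 'b) monoid_scheme \<Rightarrow> nat \<Rightarrow> nat \<Rightarrow> nat \<Rightarrow> bool"
  where "psi_bound G q M D \<longleftrightarrow> D * psi G \<le> M * cyc_psi (order G) \<and>
    (D * psi G = M * cyc_psi (order G) \<longrightarrow> (\<exists>k. elementary_times_cyclic G q k))"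

text \<open>Both parities are handled together. The condition survives division of \<open>n\<close>
  by a power of an odd prime, as the induction requires.\<close>

definition admissible :: "nat \<Rightarrow> nat \<Rightarrow> nat \<Rightarrow> nat \<Rightarrow> bool"
  where "admissible n q M D \<longleftrightarrow>
    (q = 2 \<and> M = 7 \<and> D = 11 \<and> even n) \<or> (q = 3 \<and> M = 25 \<and> D = 61 \<and> odd n)"

lemma cyc_psi_pos: "n > 0 \<Longrightarrow> cyc_psi n > 0"
  unfolding cyc_psi_def by (intro sum_pos) (auto intro: dvd_imp_le simp: div_greater_zero_iff)

lemma (in group) psi_bound_prime_power:
  assumes fin: "finite (carrier G)" and nc: "\<not> cyclic_group G"
    and p: "p = 2 \<and> M = 7 \<and> D = 11 \<or> p = 3 \<and> M = 25 \<and> D = (61::nat)"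
    and ord_G: "order G = p ^ Suc a"
    and x: "x \<in> carrier G" "\<And>w. w \<in> carrier G \<Longrightarrow> ord w \<le> ord x" "ord x = p ^ a"
  shows "psi_bound G p M D"
proof -
  have prime: "prime p" using p by auto
  have "a \<noteq> 0"
  proof
    assume "a = 0"
    then have "ord x = 1" using x(3) by simp
    then have "w = \<one>" if "w \<in> carrier G" for w
      using x(2)[OF that] ord_ge_1[OF fin that] ord_eq_1[OF that] by (metis le_antisym)
    then have "carrier G = {\<one>}" using one_closed by blast
    then have "order G = 1" by (simp add: order_def)
    then show False using ord_G \<open>a = 0\<close> p by auto
  qed
  then obtain a' where a': "a = Suc a'" by (cases a) auto
  define u where "u = p ^ a"
  have up: "p \<le> u" using p by (auto simp: u_def a')
  have "u ^ 2 \<ge> p ^ 2" using up by (rule power_mono) simp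
  have n: "order G = p * u" using ord_G by (simp add: u_def)
  have "psi G \<le> cyc_psi u + (p * u - u) * u"
    using psi_le_max_ord[OF fin x(1,2)] x(3) n by (simp add: u_def)
  then have 1: "psi G \<le> cyc_psi u + (p - 1) * u\<^sup>2"
    by (simp add: diff_mult_distrib power2_eq_square mult.assoc)
  have 2: "(p + 1) * cyc_psi u = p * u\<^sup>2 + 1" unfolding u_def by (rule cyc_psi_prime_power[OF prime])
  have 3: "(p + 1) * cyc_psi (p * u) = p * (p * u)\<^sup>2 + 1"
    using cyc_psi_prime_power[OF prime, of "Suc a"] by (simp add: u_def)
  \<comment> \<open>After clearing \<open>p + 1\<close> everything is linear in \<open>U\<close>: 55
    U + 11 <= 56 U + 7 for \<open>p = 2\<close> and 671 U + 61 <= 675 U + 25 for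
    \<open>p = 3\<close>. Both say p^2 <= U, with equality only at U = p^2.\<close>
  define U where "U = u\<^sup>2"
  have "psi G \<le> cyc_psi u + (p - 1) * U" "(p + 1) * cyc_psi u = p * U + 1"
    "(p + 1) * cyc_psi (p * u) = p * (p\<^sup>2 * U) + 1" "p\<^sup>2 \<le> U"
    using 1 2 3 \<open>u ^ 2 \<ge> p ^ 2\<close> by (simp_all add: U_def power_mult_distrib)
  then have "D * psi G \<le> M * cyc_psi (p * u) \<and> (D * psi G = M * cyc_psi (p * u) \<longrightarrow> U = p\<^sup>2)"
    using p by auto
  moreover have "\<exists>k. elementary_times_cyclic G p k" if "U = p\<^sup>2"
  proof -
    have "u = p" using that by (simp add: U_def)
    then show ?thesis using elementary_times_cyclic_prime_square[OF fin prime _ nc] n by auto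
  qed
  ultimately show ?thesis unfolding psi_bound_def n by blast
qed

text \<open>With u the maximal order, evenness gives psi(G) <= (3/4 + 2) u^2, whereas psi(C_n) >=
  (9/2) u^2; and 11 * 11/4 is less than 7 * 9/2.\<close>

lemma (in group) psi_bound_index_3:
  assumes fin: "finite (carrier G)" and ord_G: "order G = 3 * ord x" and ev: "even (order G)"
    and x: "x \<in> carrier G" "\<And>w. w \<in> carrier G \<Longrightarrow> ord w \<le> ord x"
    and low: "2 * (order G)\<^sup>2 \<le> 4 * cyc_psi (order G)"
  shows "11 * psi G < 7 * cyc_psi (order G)"
proof -
  let ?u = "ord x"
  have "?u \<ge> 1" using ord_ge_1[OF fin x(1)] .
  then have u1: "?u\<^sup>2 \<ge> 1" by simp
  have "even ?u" using ev ord_G by simp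
  then have 1: "4 * cyc_psi ?u \<le> 3 * ?u\<^sup>2" by (rule cyc_psi_le_even)
  have "psi G \<le> cyc_psi ?u + 2 * ?u\<^sup>2"
    using psi_le_max_ord[OF fin x] ord_G by (simp add: power2_eq_square)
  moreover have "18 * ?u\<^sup>2 \<le> 4 * cyc_psi (order G)" using low ord_G by (simp add: power_mult_distrib)
  ultimately show ?thesis using 1 u1 by linarith
qed

text \<open>\<open>C\<close> and \<open>N\<close> stand for psi(P) and |P|; \<open>S\<close> and
  \<open>T\<close> are the parts of psi(H) inside and outside \<open>centralizing\<close>. Most of
  psi(H) lies in \<open>T\<close>, where \<open>C\<close> is replaced by the much smaller
  \<open>N\<close>.\<close>

lemma cyclic_quotient_arith:
  fixes C N S T p q l M D :: nat
  assumes adm: "q = 2 \<and> M = 7 \<and> D = 11 \<and> 3 \<le> p \<or> q = 3 \<and> M = 25 \<and> D = 61 \<and> 5 \<le> p"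
    and l: "q \<le> l" "(l * (l - 1) + 1) * S \<le> S + T" and pos: "S + T > 0" "C > 0"
    and p: "(p * (p - 1) + 1) * N \<le> p * C"
  shows "D * (C * S + N * T) < M * (C * (S + T))"
proof -
  have L: "q * (q - 1) \<le> l * (l - 1)" using l(1) by (intro mult_le_mono diff_le_mono)
  have "q * (q - 1) * S \<le> l * (l - 1) * S" using L by (rule mult_right_mono) simp
  also have "\<dots> \<le> T" using l(2) by (simp add: add_mult_distrib)
  finally have S: "q * (q - 1) * S \<le> T" .
  have T: "T > 0" using S pos(1) adm by (cases "T = 0") auto
  from adm show ?thesis
  proof
    assume a: "q = 2 \<and> M = 7 \<and> D = 11 \<and> 3 \<le> p"
    then obtain r where r: "p = r + 3" by (metis add.commute le_Suc_ex)
    \<comment> \<open>The ratio p / (p (p - 1) + 1) is worst at p = 3, where it equals 3/7.\<close>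
    have "7 * p \<le> 3 * (p * (p - 1) + 1)" by (simp add: r algebra_simps)
    then have "7 * p * N \<le> 3 * (p * (p - 1) + 1) * N" by (rule mult_right_mono) simp
    also have "\<dots> \<le> 3 * (p * C)" using mult_le_mono2[OF p, of 3] by (simp only: mult.assoc)
    finally have "p * (7 * N) \<le> p * (3 * C)" by (simp add: mult_ac)
    then have N: "7 * N \<le> 3 * C" using r by simp
    have 1: "7 * (N * T) \<le> 3 * (C * T)" using mult_le_mono1[OF N, of T] by (simp only: mult.assoc)
    have 2: "2 * (C * S) \<le> C * T" using mult_le_mono2[OF S, of C] a by (simp add: mult.left_commute)
    have 3: "C * T > 0" using T pos by simp
    have "11 * (A + B) < 7 * (A + E)" if "7 * B \<le> 3 * E" "2 * A \<le> E" "0 < E" for A B E :: nat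
      using that by simp
    then have "11 * (C * S + N * T) < 7 * (C * S + C * T)" using 1 2 3 by blast
    then show ?thesis using a by (simp add: distrib_left)
  next
    assume a: "q = 3 \<and> M = 25 \<and> D = 61 \<and> 5 \<le> p"
    then obtain r where r: "p = r + 5" by (metis add.commute le_Suc_ex)
    \<comment> \<open>Now the worst case is p = 5, with ratio 5/21.\<close>
    have "21 * p \<le> 5 * (p * (p - 1) + 1)" by (simp add: r algebra_simps)
    then have "21 * p * N \<le> 5 * (p * (p - 1) + 1) * N" by (rule mult_right_mono) simp
    also have "\<dots> \<le> 5 * (p * C)" using mult_le_mono2[OF p, of 5] by (simp only: mult.assoc)
    finally have "p * (21 * N) \<le> p * (5 * C)" by (simp add: mult_ac)
    then have N: "21 * N \<le> 5 * C" using r by simp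
    have 1: "21 * (N * T) \<le> 5 * (C * T)" using mult_le_mono1[OF N, of T] by (simp only: mult.assoc)
    have 2: "6 * (C * S) \<le> C * T" using mult_le_mono2[OF S, of C] a by (simp add: mult.left_commute)
    have 3: "C * T > 0" using T pos by simp
    have "61 * (A + B) < 25 * (A + E)" if "21 * B \<le> 5 * E" "6 * A \<le> E" "0 < E" for A B E :: nat
      using that by simp
    then have "61 * (C * S + N * T) < 25 * (C * S + C * T)" using 1 2 3 by blast
    then show ?thesis using a by (simp add: distrib_left)
  qed
qed

text \<open>For non-cyclic \<open>H\<close>, \<open>psi_le\<close> and the bound for
  \<open>H\<close> multiply, as \<open>cyc_psi\<close> is multiplicative. Equality makes both sharp:
  P is central and \<open>H\<close> extremal, and the structure lifts. For cyclic \<open>H\<close>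
  the inequality is strict.\<close>

lemma (in cyclic_prime_power_kernel) psi_bound_from_quotient:
  assumes b: "b > 0" and nc: "\<not> cyclic_group G"
    and adm: "admissible (order H) q M D" and pq: "q < p" and pr: "q = 3 \<Longrightarrow> p \<ge> 5"
    and IH: "\<not> cyclic_group H \<Longrightarrow> psi_bound H q M D"
  shows "psi_bound G q M D"
proof -
  have cH: "cyc_psi (order G) = cyc_psi (p ^ b) * cyc_psi (order H)"
    unfolding order_eq using cop by (intro cyc_psi_mult_coprime) simp
  have oH: "order H > 0" using fin_H H.order_gt_0_iff_finite by blast
  have C: "cyc_psi (p ^ b) > 0" using p_pos by (intro cyc_psi_pos) simp
  have M: "M > 0" "D > 0" and primeq: "prime q" using adm by (auto simp: admissible_def)
  show ?thesis
  proof (cases "cyclic_group H")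
    case False
    then have IH': "D * psi H \<le> M * cyc_psi (order H)"
      "D * psi H = M * cyc_psi (order H) \<Longrightarrow> \<exists>k. elementary_times_cyclic H q k"
      using IH by (auto simp: psi_bound_def)
    have 1: "D * psi G \<le> D * (cyc_psi (p ^ b) * psi H)" using psi_le(1)[OF b] by simp
    have 2: "cyc_psi (p ^ b) * (D * psi H) \<le> cyc_psi (p ^ b) * (M * cyc_psi (order H))"
      using IH'(1) by simp
    have 3: "M * cyc_psi (order G) = cyc_psi (p ^ b) * (M * cyc_psi (order H))"
      "D * (cyc_psi (p ^ b) * psi H) = cyc_psi (p ^ b) * (D * psi H)"
      by (simp_all add: cH)
    have "\<exists>k. elementary_times_cyclic G q k" if eq: "D * psi G = M * cyc_psi (order G)"
    proof -
      have "D * psi G = D * (cyc_psi (p ^ b) * psi H)" using 1 2 3 eq by linarith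
      then have central: "centralizing = carrier H" using psi_le(2)[OF b] M by simp
      have "cyc_psi (p ^ b) * (D * psi H) = cyc_psi (p ^ b) * (M * cyc_psi (order H))"
        using 1 2 3 eq by linarith
      then have "D * psi H = M * cyc_psi (order H)" using C by simp
      then show ?thesis using IH'(2) elementary_times_cyclic_lift[OF central _ primeq] pq by blast
    qed
    moreover have "D * psi G \<le> M * cyc_psi (order G)" using 1 2 3 by linarith
    ultimately show ?thesis unfolding psi_bound_def by blast
  next
    case True
    obtain S T l where ST: "psi G = cyc_psi (p ^ b) * S + p ^ b * T" "S + T = cyc_psi (order H)"
        "prime l" "l dvd order H" "(l * (l - 1) + 1) * S \<le> cyc_psi (order H)"
      using psi_cyclic_quotient[OF True nc] .
    have "q \<le> l"
    proof (cases "q = 2")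
      case False
      then have "odd (order H)" "q = 3" using adm by (auto simp: admissible_def)
      then show ?thesis using ST(3,4) prime_ge_2_nat[OF ST(3)] by (cases "l = 2") auto
    qed (use prime_ge_2_nat[OF ST(3)] in simp)
    then have "D * (cyc_psi (p ^ b) * S + p ^ b * T) < M * (cyc_psi (p ^ b) * (S + T))"
      using adm pq pr ST C cyc_psi_pos[OF oH] prime_power_le_cyc_psi[OF p b]
      by (intro cyclic_quotient_arith) (auto simp: admissible_def)
    then show ?thesis unfolding psi_bound_def using ST cH by simp
  qed
qed

text \<open>The index \<open>k\<close> is prime to \<open>p\<close>, so the subgroup of
  \<open>x\<close> contains an element \<open>y\<close> of order p^b. Conjugates of \<open>y\<close>
  stay in that cyclic subgroup and keep p^b-th power 1, so they fall back into the subgroup of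
  \<open>y\<close>, which is therefore normal.\<close>

lemma (in group) psi_bound_small_index:
  assumes fin: "finite (carrier G)" and nc: "\<not> cyclic_group G"
    and adm: "admissible (order G) q M D"
    and x: "x \<in> carrier G" and idx: "order G = k * ord x" "k < p"
    and p: "prime p" "p dvd order G" and pq: "q < p" and pr: "q = 3 \<Longrightarrow> p \<ge> 5"
    and IH: "\<And>H :: 'a monoid. group H \<Longrightarrow> finite (carrier H) \<Longrightarrow> \<not> cyclic_group H \<Longrightarrow>
      order H < order G \<Longrightarrow> admissible (order H) q M D \<Longrightarrow> psi_bound H q M D"
  shows "psi_bound G q M D"
proof -
  have n0: "order G > 0" using fin order_gt_0_iff_finite by blast
  obtain b m where m: "order G = p ^ b * m" "\<not> p dvd m" "coprime (p ^ b) m" "m > 0"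
    using prime_power_decomp[OF p(1) n0] .
  have b: "b > 0" using m p(2) by (cases b) auto
  have k0: "k > 0" using idx n0 by (cases k) auto
  have ox: "ord x > 0" using ord_ge_1[OF fin x] by simp
  have "coprime (p ^ b) k"
    using p(1) k0 idx(2) by (metis coprime_power_left_iff nat_dvd_not_less prime_imp_coprime)
  moreover have "p ^ b dvd k * ord x" using m idx by (metis dvd_triv_left)
  ultimately have dvd: "p ^ b dvd ord x" using coprime_dvd_mult_right_iff by blast
  define y where "y = x [^] (ord x div p ^ b)"
  have p0: "p > 1" using p(1) prime_gt_1_nat by blast
  have yG: "y \<in> carrier G" using x by (simp add: y_def)
  have quot: "ord x div p ^ b dvd ord x" "ord x div p ^ b \<noteq> 0" "ord x div (ord x div p ^ b) = p ^ b"
    using dvd ox p0 by (auto simp: div_dvd_iff_mult dvd_div_eq_0_iff)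
  then have oy: "ord y = p ^ b" using ord_pow[OF x] by (simp add: y_def)
  have oy0: "ord y > 0" using oy p0 by simp
  have y_in: "y \<in> generate G {x}"
    using generate_pow_nat[OF x] ox by (auto simp: y_def)
  have normal: "generate G {y} \<lhd> G"
  proof (rule normal_generate_singleton[OF yG _ oy0])
    fix g assume g: "g \<in> carrier G"
    have "g \<otimes> y \<otimes> inv g \<in> generate G {x}"
      using conj_mem_small_index[OF fin generate_is_subgroup y_in oy p(1) _ g] x idx
        generate_pow_card[OF x] by simp
    moreover have "(g \<otimes> y \<otimes> inv g) [^] (p ^ b) = \<one>"
      using conj_nat_pow[OF g yG, of "p ^ b"] yG g oy pow_ord_eq_1[OF yG] by simp
    ultimately show "g \<otimes> y \<otimes> inv g \<in> generate G {y}"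
      using generate_mem_of_pow[OF x ox dvd] y_def by simp
  qed
  obtain H :: "'a monoid" and \<phi> where H: "group_hom G H \<phi>" "\<phi> ` carrier G = carrier H"
      "kernel G H \<phi> = generate G {y}"
    using quotient_same_type[OF normal] .
  interpret \<phi>: group_hom G H \<phi> by (rule H(1))
  have "order G = card (kernel G H \<phi>) * order H"
  proof -
    have "order (G Mod kernel G H \<phi>) = order H"
      using \<phi>.FactGroup_iso H(2) iso_same_card unfolding order_def by blast
    then show ?thesis
      using lagrange[OF normal_imp_subgroup[OF normal]] H(3) by (simp add: order_def FactGroup_def mult.commute)
  qed
  then have "order G = p ^ b * order H" using H(3) generate_pow_card[OF yG] oy by simp
  then have oH: "order H = m" using m p0 by simp
  have "coprime p (order H)" using m(2) oH p(1) prime_imp_coprime by blast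
  then interpret K: cyclic_prime_power_kernel G H \<phi> y p b
    using H yG oy p(1) fin by unfold_locales auto
  have "m < order G" using m one_less_power[OF p0 b] by simp
  moreover have "admissible m q M D"
  proof -
    have "odd p" using pq adm p(1) p0 prime_odd_nat[OF p(1)] by (auto simp: admissible_def)
    then show ?thesis using adm m(1) by (auto simp: admissible_def)
  qed
  ultimately show ?thesis
    using K.psi_bound_from_quotient[OF b nc _ pq pr] IH[OF \<phi>.H.is_group K.fin_H] oH by simp
qed

lemma prime_power_of_only_prime:
  fixes n p :: nat
  assumes "n > 0" "prime p" "\<And>r. prime r \<Longrightarrow> r dvd n \<Longrightarrow> r = p"
  obtains a where "n = p ^ a"
proof -
  obtain b m where m: "n = p ^ b * m" "\<not> p dvd m" "coprime (p ^ b) m" "m > 0"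
    using prime_power_decomp[OF assms(2,1)] .
  have "m = 1" using m assms(3) by (metis dvd_mult prime_factor_nat)
  then show ?thesis using m that by simp
qed

lemma (in group) psi_bound_step:
  assumes fin: "finite (carrier G)" and nc: "\<not> cyclic_group G"
    and adm: "admissible (order G) q M D"
    and IH: "\<And>H :: 'a monoid. group H \<Longrightarrow> finite (carrier H) \<Longrightarrow> \<not> cyclic_group H \<Longrightarrow>
      order H < order G \<Longrightarrow> admissible (order H) q M D \<Longrightarrow> psi_bound H q M D"
  shows "psi_bound G q M D"
proof (cases "D * psi G < M * cyc_psi (order G)")
  case True
  then show ?thesis by (simp add: psi_bound_def)
next
  case False
  let ?n = "order G"
  have n0: "?n > 0" using fin order_gt_0_iff_finite by blast
  have n1: "?n \<noteq> 1" using nc cyclic_group_iff_ord[OF fin] ord_id by (metis one_closed)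
  obtain p where p: "prime p" "p dvd ?n" and pmax: "\<And>r. prime r \<Longrightarrow> r dvd ?n \<Longrightarrow> r \<le> p"
  proof -
    have "finite (prime_factors ?n)" "prime_factors ?n \<noteq> {}"
      using n0 n1 prime_factorization_empty_iff[of ?n] by auto
    then have "Max (prime_factors ?n) \<in> prime_factors ?n" "\<And>r. r \<in> prime_factors ?n \<Longrightarrow> r \<le> Max (prime_factors ?n)"
      by auto
    then show ?thesis using that[of "Max (prime_factors ?n)"] n0
      by (simp add: prime_factors_dvd in_prime_factors_iff)
  qed
  have pmin: "q \<le> r" if r: "prime r" "r dvd ?n" for r
  proof (cases "q = 2")
    case False
    then have "odd ?n" "q = 3" using adm by (auto simp: admissible_def)
    then show ?thesis using r prime_ge_2_nat[OF r(1)] by (cases "r = 2") auto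
  qed (use prime_ge_2_nat[OF r(1)] in simp)
  have q0: "q > 0" using adm by (auto simp: admissible_def)
  \<comment> \<open>All primes dividing n lie in the range from \<open>q\<close> to
    \<open>p\<close>, so the telescoped bound applies with \<open>s = p + 1\<close>.\<close>
  have low: "q * ?n\<^sup>2 \<le> (p + 1) * cyc_psi ?n"
    using cyc_psi_lower_bound[of ?n q "p + 1"] n0 q0 pmin[OF p] pmin pmax by (simp add: less_Suc_eq_le)
  have "\<exists>x\<in>carrier G. \<forall>w\<in>carrier G. ord w \<le> ord x"
  proof -
    have "Max (ord ` carrier G) \<in> ord ` carrier G" using fin by (intro Max_in) auto
    then obtain x where "x \<in> carrier G" "ord x = Max (ord ` carrier G)" by auto
    then show ?thesis using fin by (intro bexI[of _ x]) auto
  qed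
  then obtain x where x: "x \<in> carrier G" and xmax: "\<And>w. w \<in> carrier G \<Longrightarrow> ord w \<le> ord x" by blast
  obtain k where k: "?n = k * ord x" using ord_dvd_group_order[OF x] by (metis dvdE mult.commute)
  have ox: "ord x > 0" using ord_ge_1[OF fin x] by simp
  have k1: "k \<noteq> 1" using nc cyclic_group_iff_ord[OF fin] x k by auto
  have k0: "k \<noteq> 0" using k n0 by (cases k) auto
  have psi_up: "psi G \<le> ?n * ord x"
    unfolding psi_def order_def using sum_bounded_above[of "carrier G" ord "ord x"] xmax by simp
  \<comment> \<open>The lower bound for psi(C_n) meets psi(G) <= n * \<open>ord x\<close> = n^2 / k;
    cancelling n^2 / k leaves a bound on the index \<open>k\<close> linear in
    \<open>p\<close>.\<close>
  have "M * (q * ?n\<^sup>2) \<le> M * ((p + 1) * cyc_psi ?n)" using low by simp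
  also have "\<dots> = (p + 1) * (M * cyc_psi ?n)" by (rule mult.left_commute)
  also have "\<dots> \<le> (p + 1) * (D * psi G)" using False by (intro mult_le_mono2) simp
  also have "\<dots> \<le> (p + 1) * (D * (?n * ord x))" using psi_up by (intro mult_le_mono2)
  also have "\<dots> = (?n * ord x) * (D * (p + 1))" by (simp only: mult_ac)
  also have "M * (q * ?n\<^sup>2) = M * (q * (?n * (k * ord x)))"
    by (simp only: power2_eq_square k[symmetric])
  also have "\<dots> = (?n * ord x) * (M * q * k)" by (simp only: mult_ac)
  finally have "(?n * ord x) * (M * q * k) \<le> (?n * ord x) * (D * (p + 1))" .
  then have key: "M * q * k \<le> D * (p + 1)" using n0 ox by simp
  have p2: "p \<ge> 2" using p(1) prime_ge_2_nat by blast
  have q_le_p: "q \<le> p" using pmin p by blast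
  have odd_k: "odd k" "odd p" if "q = 3"
  proof -
    have "odd ?n" using that adm by (auto simp: admissible_def)
    then show "odd k" "odd p" using k p(2) by (metis dvd_mult2, metis dvd_trans)
  qed
  show ?thesis
  proof (cases "k < p")
    case True
    \<comment> \<open>If p = q <= 3, then 1 < k < p leaves only k = 2 with q = 3, but
      \<open>k\<close> divides an odd number.\<close>
    have "q < p"
    proof (rule ccontr)
      assume "\<not> q < p"
      then have "p = q" using q_le_p by simp
      moreover have "q = 2 \<or> q = 3" using adm by (auto simp: admissible_def)
      ultimately have "k = 2" "q = 3" using True k0 k1 by auto
      then show False using odd_k by simp
    qed
    moreover have "p \<ge> 5" if "q = 3"
      using \<open>q < p\<close> that odd_k(2) by (cases "p = 4") auto
    ultimately show ?thesis
      using psi_bound_small_index[OF fin nc adm x k True p] IH by blast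
  next
    case False
    \<comment> \<open>Together with p <= k this gives p <= 3 or p <= 4 respectively, and 4 is not
      prime.\<close>
    have k4: "14 * k \<le> 11 * p + 11 \<or> 75 * k \<le> 61 * p + 61"
      using adm key by (auto simp: admissible_def)
    have "p \<noteq> 4" using p(1) by auto
    moreover have "p \<le> 4" using k4 False by linarith
    ultimately have p3: "p = 2 \<or> p = 3" using p2 by linarith
    have "p = 2 \<and> (k = 2 \<or> k = 3) \<or> p = 3 \<and> k = 3"
      using k4 p3 False by (elim disjE) auto
    then consider "q = 2" "p = 2" "k = 2" | "q = 3" "p = 3" "k = 3" | "q = 2" "p = 3" "k = 3"
      using adm key q_le_p by (auto simp: admissible_def)
    then show ?thesis
    proof cases
      case 3
      then have "11 * psi G < 7 * cyc_psi ?n"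
        using adm low k x xmax by (intro psi_bound_index_3[OF fin _ _ x]) (auto simp: admissible_def)
      then show ?thesis using adm 3 by (auto simp: psi_bound_def admissible_def)
    next
      case 1
      \<comment> \<open>Every prime divisor lies between \<open>q\<close> and \<open>p\<close>,
        which coincide here.\<close>
      obtain a where a: "?n = p ^ a"
        using prime_power_of_only_prime[OF n0 p(1)] pmin pmax 1 by (metis le_antisym)
      then obtain a' where a': "a = Suc a'" using n1 by (cases a) auto
      have "ord x = p ^ a'" using a a' k 1 by simp
      then show ?thesis
        using psi_bound_prime_power[OF fin nc, of p M D a' x] adm a a' x xmax 1 by (auto simp: admissible_def)
    next
      case 2
      obtain a where a: "?n = p ^ a"
        using prime_power_of_only_prime[OF n0 p(1)] pmin pmax 2 by (metis le_antisym)
      then obtain a' where a': "a = Suc a'" using n1 by (cases a) auto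
      have "ord x = p ^ a'" using a a' k 2 by simp
      then show ?thesis
        using psi_bound_prime_power[OF fin nc, of p M D a' x] adm a a' x xmax 2 by (auto simp: admissible_def)
    qed
  qed
qed

text \<open>The strong induction runs on plain monoids, the type in which
  \<open>quotient_same_type\<close> delivers quotients. A group record with extra fields is reached
  by one further \<open>psi_bound_step\<close> in \<open>psi_ratio\<close>.\<close>

lemma psi_bound_monoid:
  fixes G :: "'a monoid"
  assumes "group G" "finite (carrier G)" "\<not> cyclic_group G" "admissible (order G) q M D"
  shows "psi_bound G q M D"
  using assms
proof (induction "order G" arbitrary: G rule: less_induct)
  case less
  show ?case by (rule group.psi_bound_step[OF less.prems]) (use less.hyps in blast)
qed

section \<open>The ratio form and the equality case\<close>

lemma psi_ratio:
  fixes G :: "('a, 'b) monoid_scheme"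
  assumes G: "group G" and fin: "finite (carrier G)" and nc: "\<not> cyclic_group G"
    and adm: "admissible (order G) q M D"
  shows "real (psi G) / real (psi (cyc (order G))) \<le> real M / real D"
    and "real (psi G) / real (psi (cyc (order G))) = real M / real D \<longleftrightarrow>
      (\<exists>k. order G = q * q * k \<and> coprime q k \<and> G \<cong> cyc q \<times>\<times> cyc q \<times>\<times> cyc k)"
proof -
  interpret group G by fact
  have n0: "order G > 0" using fin order_gt_0_iff_finite by blast
  have D: "D > 0" "prime q" using adm by (auto simp: admissible_def)
  have c: "cyc_psi (order G) > 0" using cyc_psi_pos[OF n0] .
  have bound: "psi_bound G q M D"
    by (rule psi_bound_step[OF fin nc adm psi_bound_monoid])
  have *: "real (psi G) / real (cyc_psi (order G)) \<le> real M / real D \<longleftrightarrow> D * psi G \<le> M * cyc_psi (order G)"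
    using c D by (simp add: field_simps flip: of_nat_mult)
  have **: "real (psi G) / real (cyc_psi (order G)) = real M / real D \<longleftrightarrow> D * psi G = M * cyc_psi (order G)"
    using c D by (simp add: field_simps flip: of_nat_mult)
  show "real (psi G) / real (psi (cyc (order G))) \<le> real M / real D"
    using bound * psi_cyc[OF n0] by (simp add: psi_bound_def)
  show "real (psi G) / real (psi (cyc (order G))) = real M / real D \<longleftrightarrow>
      (\<exists>k. order G = q * q * k \<and> coprime q k \<and> G \<cong> cyc q \<times>\<times> cyc q \<times>\<times> cyc k)"
    unfolding psi_cyc[OF n0] **
  proof
    assume "D * psi G = M * cyc_psi (order G)"
    then obtain k where k: "elementary_times_cyclic G q k" using bound by (auto simp: psi_bound_def)
    then have "order G = q * q * k" "coprime q k" by (auto simp: elementary_times_cyclic_def)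
    then show "\<exists>k. order G = q * q * k \<and> coprime q k \<and> G \<cong> cyc q \<times>\<times> cyc q \<times>\<times> cyc k"
      using iso_elementary_times_cyclic[OF fin D(2) k] by blast
  next
    assume "\<exists>k. order G = q * q * k \<and> coprime q k \<and> G \<cong> cyc q \<times>\<times> cyc q \<times>\<times> cyc k"
    then obtain k where k: "order G = q * q * k" "coprime q k" "G \<cong> cyc q \<times>\<times> cyc q \<times>\<times> cyc k" by blast
    have k0: "k > 0" using k(1) n0 by (cases k) auto
    \<comment> \<open>The common factor \<open>cyc_psi k\<close> cancels in the ratio; the remaining
      factors are 7 and 11, or 25 and 61.\<close>
    have "psi G = (1 + q * (q * q - 1)) * cyc_psi k"
      using psi_iso[OF G _ k(3)] psi_cyc_cyc_cyc[OF D(2) k0 k(2)] by (simp add: DirProd_group)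
    moreover have "cyc_psi (order G) = cyc_psi (q * q) * cyc_psi k"
      unfolding k(1) using k(2) by (intro cyc_psi_mult_coprime) simp
    moreover have "(q + 1) * cyc_psi (q * q) = q * (q * q)\<^sup>2 + 1"
      using cyc_psi_prime_power[OF D(2), of 2] by (simp add: power2_eq_square)
    ultimately show "D * psi G = M * cyc_psi (order G)"
      using adm by (auto simp: admissible_def)
  qed
qed

theorem theorem10:
  fixes G :: "('a, 'b) monoid_scheme" and n :: nat
  assumes "group G" and "finite (carrier G)" and "order G = n" and "\<not> cyclic_group G"
  shows "(even n \<longrightarrow>
            real (psi G) / real (psi (cyc n)) \<le> 7 / 11 \<and>
            (real (psi G) / real (psi (cyc n)) = 7 / 11 \<longleftrightarrow>
              (\<exists>k. n = 4 * k \<and> gcd k 2 = 1 \<and> G \<cong> cyc 2 \<times>\<times> cyc 2 \<times>\<times> cyc k))) \<and>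
         (odd n \<longrightarrow>
            real (psi G) / real (psi (cyc n)) \<le> 25 / 61 \<and>
            (real (psi G) / real (psi (cyc n)) = 25 / 61 \<longleftrightarrow>
              (\<exists>k. n = 9 * k \<and> gcd k 6 = 1 \<and> G \<cong> cyc 3 \<times>\<times> cyc 3 \<times>\<times> cyc k)))"
proof (intro conjI impI)
  assume "even n"
  then have adm: "admissible (order G) 2 7 11" using assms by (simp add: admissible_def)
  show "real (psi G) / real (psi (cyc n)) \<le> 7 / 11"
    using psi_ratio(1)[OF assms(1,2,4) adm] assms(3) by simp
  show "real (psi G) / real (psi (cyc n)) = 7 / 11 \<longleftrightarrow>
      (\<exists>k. n = 4 * k \<and> gcd k 2 = 1 \<and> G \<cong> cyc 2 \<times>\<times> cyc 2 \<times>\<times> cyc k)"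
    using psi_ratio(2)[OF assms(1,2,4) adm] assms(3)
    by (simp add: coprime_iff_gcd_eq_1 gcd.commute)
next
  assume odd: "odd n"
  then have adm: "admissible (order G) 3 25 61" using assms by (simp add: admissible_def)
  show "real (psi G) / real (psi (cyc n)) \<le> 25 / 61"
    using psi_ratio(1)[OF assms(1,2,4) adm] assms(3) by simp
  \<comment> \<open>Since n is odd, so is \<open>k\<close>; being prime to 6 then amounts to being
    prime to 3.\<close>
  have gcd6: "gcd k 6 = 1 \<longleftrightarrow> coprime 3 k" if "n = 9 * k" for k
  proof -
    have "odd k" using odd that by simp
    then have "coprime k 2" by (simp add: coprime_commute)
    moreover have "coprime k 6 \<longleftrightarrow> coprime k 2 \<and> coprime k 3"
      using coprime_mult_right_iff[of k 2 3] by simp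
    ultimately show ?thesis
      unfolding coprime_iff_gcd_eq_1[symmetric] by (simp add: coprime_commute)
  qed
  show "real (psi G) / real (psi (cyc n)) = 25 / 61 \<longleftrightarrow>
      (\<exists>k. n = 9 * k \<and> gcd k 6 = 1 \<and> G \<cong> cyc 3 \<times>\<times> cyc 3 \<times>\<times> cyc k)"
    using psi_ratio(2)[OF assms(1,2,4) adm] assms(3) gcd6 by auto
qed

end
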